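(* Let $n\ge 2$ and let $\psi:\Sigma^n\to\mathcal H^{n+1}$ be a complete spacelike vertical graph in the $(n+1)$-dimensional Steady State space $\mathcal H^{n+1}=-\mathbb R\times_{e^t}\mathbb R^n$, with constant mean curvature $H\ge 1$. Let $h$ be its height function and $\theta$ its hyperbolic angle. If $$h\le-\log(\cosh\theta-1)$$ on $\Sigma$, where the right-hand side is interpreted as $+\infty$ at points where $\cosh\theta=1$, then: (a) $H=1$ on $\Sigma$. (b) The scalar curvature $R$ of $\Sigma$ is nonnegative and not globally bounded away from zero, i.e. $R\ge 0$ on $\Sigma$ and there is no constant $\alpha>0$ with $R\ge\alpha$ on all of $\Sigma$.
   Context: The Steady State space $\mathcal H^{n+1}=-\mathbb R\times_{e^t}\mathbb R^n$ is the manifold $\mathbb R\times\mathbb R^n$ with the Lorentzian metric $\langle\,,\rangle=-dt^2+e^{2t}\langle\,,\rangle_{\mathbb R^n}$, where $\langle\,,\rangle_{\mathbb R^n}$ is the Euclidean metric; $\partial_t$ is the coordinate vector field of the first factor, and the slices are the sets $\{t_0\}\times\mathbb R^n$. A (spacelike) vertical graph is an immersion $\psi$ with Riemannian induced metric of the form $\psi(x)=(u(x),x)$ for a smooth function $u:\mathbb R^n\to[0,+\infty)$, so that $\Sigma$ is identified with $\mathbb R^n$ (the slice $\{0\}\times\mathbb R^n$) endowed with the metric induced by $\psi$. Complete means that this induced metric is complete. The height function $h:\Sigma\to\mathbb R$ is the restriction to $\Sigma$ of the projection onto the first factor; thus $h=u\ge0$. $\Sigma$ is oriented by the timelike unit normal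 field $N$ with $\langle N,\partial_t\rangle<0$; the hyperbolic angle is the function $\theta\ge 0$ with $\cosh\theta=-\langle N,\partial_t\rangle\ge 1$. With $\overline\nabla$ the Levi-Civita connection of $\mathcal H^{n+1}$, the shape operator is $AX=-\overline\nabla_XN$ and the mean curvature is $H=-\mathrm{tr}(A)/n$ (with this convention the slices, oriented by $N=\partial_t$, have $H=1$). *)

theory Defs
  imports "HOL-Analysis.Analysis"
begin

text \<open>
  Pseudo-Riemannian metrics are considered on a whole Euclidean space \<open>'a\<close>, all of whose tangent
  spaces are identified with \<open>'a\<close>: \<open>g p v w\<close> is the scalar product at \<open>p\<close> of \<open>v\<close> and \<open>w\<close>.
  This covers both the Steady State space (on \<open>\<real> \<times> \<real>\<^sup>n\<close>) and the entire graph (on \<open>\<real>\<^sup>n\<close>).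
\<close>

type_synonym 'a metric = "'a \<Rightarrow> 'a \<Rightarrow> 'a \<Rightarrow> real"

primrec C_k :: "nat \<Rightarrow> ('a::euclidean_space \<Rightarrow> 'b::real_normed_vector) \<Rightarrow> bool" where
  "C_k 0 f \<longleftrightarrow> continuous_on UNIV f"
| "C_k (Suc k) f \<longleftrightarrow>
     (\<forall>x. f differentiable (at x)) \<and> (\<forall>v. C_k k (\<lambda>x. frechet_derivative f (at x) v))"

definition smooth :: "('a::euclidean_space \<Rightarrow> 'b::real_normed_vector) \<Rightarrow> bool" where
  "smooth f \<longleftrightarrow> (\<forall>k. C_k k f)"

definition riemannian :: "'a::euclidean_space metric \<Rightarrow> bool" where
  "riemannian g \<longleftrightarrow> (\<forall>p v. v \<noteq> 0 \<longrightarrow> g p v v > 0)"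

text \<open>The vector representing the linear form \<open>\<phi>\<close>; unique since \<open>g p\<close> is nondegenerate.\<close>

definition sharp :: "'a::euclidean_space metric \<Rightarrow> 'a \<Rightarrow> ('a \<Rightarrow> real) \<Rightarrow> 'a" where
  "sharp g p \<phi> = (THE x. \<forall>z. g p x z = \<phi> z)"

text \<open>Trace of a linear endomorphism.\<close>

definition lin_trace :: "('a::euclidean_space \<Rightarrow> 'a) \<Rightarrow> real" where
  "lin_trace L = (\<Sum>b\<in>Basis. L b \<bullet> b)"

text \<open>
  Christoffel form of the Levi-Civita connection: the Koszul formula for the constant fields
  \<open>v\<close>, \<open>w\<close>, \<open>z\<close>, whose Lie brackets vanish.
\<close>

definition christoffel :: "'a::euclidean_space metric \<Rightarrow> 'a \<Rightarrow> 'a \<Rightarrow> 'a \<Rightarrow> 'a" where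
  "christoffel g p v w = sharp g p (\<lambda>z.
     (frechet_derivative (\<lambda>q. g q w z) (at p) v
      + frechet_derivative (\<lambda>q. g q v z) (at p) w
      - frechet_derivative (\<lambda>q. g q v w) (at p) z) / 2)"

text \<open>
  Levi-Civita covariant derivative, at \<open>x\<close> in direction \<open>v\<close>, of a vector field \<open>Y\<close> along a map
  \<open>\<psi>\<close> into the space carrying \<open>g\<close>.
\<close>

definition cov_deriv_along ::
  "'b::euclidean_space metric \<Rightarrow> ('a::euclidean_space \<Rightarrow> 'b) \<Rightarrow> ('a \<Rightarrow> 'b) \<Rightarrow> 'a \<Rightarrow> 'a \<Rightarrow> 'b" where
  "cov_deriv_along g \<psi> Y x v =
     frechet_derivative Y (at x) v
     + christoffel g (\<psi> x) (frechet_derivative \<psi> (at x) v) (Y x)"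

abbreviation cov_deriv ::
  "'a::euclidean_space metric \<Rightarrow> ('a \<Rightarrow> 'a) \<Rightarrow> 'a \<Rightarrow> 'a \<Rightarrow> 'a" where
  "cov_deriv g \<equiv> cov_deriv_along g (\<lambda>x. x)"

text \<open>
  \<open>R(v,w)z = \<nabla>\<^sub>v\<nabla>\<^sub>wz - \<nabla>\<^sub>w\<nabla>\<^sub>vz - \<nabla>\<^bsub>[v,w]\<^esub>z\<close> at \<open>p\<close>. By tensoriality the vectors may be extended to
  constant fields, and the bracket term then vanishes.
\<close>

definition riemann_curvature ::
  "'a::euclidean_space metric \<Rightarrow> 'a \<Rightarrow> 'a \<Rightarrow> 'a \<Rightarrow> 'a \<Rightarrow> 'a" where
  "riemann_curvature g p v w z =
     cov_deriv g (\<lambda>q. cov_deriv g (\<lambda>_. z) q w) p v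
     - cov_deriv g (\<lambda>q. cov_deriv g (\<lambda>_. z) q v) p w"

definition ricci :: "'a::euclidean_space metric \<Rightarrow> 'a \<Rightarrow> 'a \<Rightarrow> 'a \<Rightarrow> real" where
  "ricci g p w z = lin_trace (\<lambda>v. riemann_curvature g p v w z)"

definition scalar_curvature :: "'a::euclidean_space metric \<Rightarrow> 'a \<Rightarrow> real" where
  "scalar_curvature g p = lin_trace (\<lambda>v. sharp g p (ricci g p v))"

definition curve_speed :: "'a::euclidean_space metric \<Rightarrow> (real \<Rightarrow> 'a) \<Rightarrow> real \<Rightarrow> real" where
  "curve_speed g \<gamma> t =
     sqrt (g (\<gamma> t) (vector_derivative \<gamma> (at t)) (vector_derivative \<gamma> (at t)))"

text \<open>
  Infimum of the lengths of piecewise \<open>C\<^sup>1\<close> curves. The derivative of a \<^const>\<open>valid_path\<close> may be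
  unbounded near the break points, and \<^const>\<open>integral\<close> is \<open>0\<close> for a function that is not integrable,
  so curves of infinite length have to be excluded explicitly.
\<close>

definition riem_dist :: "'a::euclidean_space metric \<Rightarrow> 'a \<Rightarrow> 'a \<Rightarrow> real" where
  "riem_dist g p q = Inf {integral {0..1} (curve_speed g \<gamma>) |\<gamma>.
     valid_path \<gamma> \<and> pathstart \<gamma> = p \<and> pathfinish \<gamma> = q \<and> curve_speed g \<gamma> integrable_on {0..1}}"

definition riem_complete :: "'a::euclidean_space metric \<Rightarrow> bool" where
  "riem_complete g \<longleftrightarrow> Metric_space.mcomplete UNIV (riem_dist g)"

definition induced_metric ::
  "'b::euclidean_space metric \<Rightarrow> ('a::euclidean_space \<Rightarrow> 'b) \<Rightarrow> 'a metric" where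
  "induced_metric g \<psi> x v w =
     g (\<psi> x) (frechet_derivative \<psi> (at x) v) (frechet_derivative \<psi> (at x) w)"

text \<open>\<open>A X = -\<nabla>\<^sub>X N\<close>, which is tangent, read as an endomorphism of the domain through \<open>d\<psi>\<close>.\<close>

definition shape_operator ::
  "'b::euclidean_space metric \<Rightarrow> ('a::euclidean_space \<Rightarrow> 'b) \<Rightarrow> ('a \<Rightarrow> 'b) \<Rightarrow> 'a \<Rightarrow> 'a \<Rightarrow> 'a" where
  "shape_operator g \<psi> N x v =
     (THE w. frechet_derivative \<psi> (at x) w = - cov_deriv_along g \<psi> N x v)"

text \<open>The sign is the one for spacelike hypersurfaces with timelike normal.\<close>

definition mean_curvature ::
  "'b::euclidean_space metric \<Rightarrow> ('a::euclidean_space \<Rightarrow> 'b) \<Rightarrow> ('a \<Rightarrow> 'b) \<Rightarrow> 'a \<Rightarrow> real" where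
  "mean_curvature g \<psi> N x = - lin_trace (shape_operator g \<psi> N x) / real DIM('a)"

definition steady_state_metric :: "(real \<times> (real^'n)) metric" where
  "steady_state_metric p v w = - (fst v * fst w) + exp (2 * fst p) * (snd v \<bullet> snd w)"

definition d_t :: "real \<times> (real^'n)" where
  "d_t = (1, 0)"

definition vertical_graph :: "(real^'n \<Rightarrow> real) \<Rightarrow> real^'n \<Rightarrow> real \<times> (real^'n)" where
  "vertical_graph u x = (u x, x)"

definition height :: "(real^'n \<Rightarrow> real \<times> (real^'n)) \<Rightarrow> real^'n \<Rightarrow> real" where
  "height \<psi> x = fst (\<psi> x)"

definition future_unit_normal ::
  "(real^'n \<Rightarrow> real \<times> (real^'n)) \<Rightarrow> (real^'n \<Rightarrow> real \<times> (real^'n)) \<Rightarrow> bool" where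
  "future_unit_normal \<psi> N \<longleftrightarrow> (\<forall>x.
     (\<forall>v. steady_state_metric (\<psi> x) (N x) (frechet_derivative \<psi> (at x) v) = 0) \<and>
     steady_state_metric (\<psi> x) (N x) (N x) = - 1 \<and>
     steady_state_metric (\<psi> x) (N x) d_t < 0)"

definition hyperbolic_angle ::
  "(real^'n \<Rightarrow> real \<times> (real^'n)) \<Rightarrow> (real^'n \<Rightarrow> real \<times> (real^'n)) \<Rightarrow> (real^'n \<Rightarrow> real) \<Rightarrow> bool" where
  "hyperbolic_angle \<psi> N \<theta> \<longleftrightarrow>
     (\<forall>x. \<theta> x \<ge> 0 \<and> cosh (\<theta> x) = - steady_state_metric (\<psi> x) (N x) d_t)"

end

(*
In the coordinate V = exp (- t) the Steady State space is conformal to a half space of Minkowski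
space, and the graph is described by V = exp (- u), by the Euclidean gradient p of V, by
c = cosh \<theta> = 1 / sqrt (1 - |p|^2) and by q = c p. With W minus the shape operator, the function
f = exp h (cosh \<theta> - 1) = (c - 1) / V satisfies
  V Lap f = c tr W^2 - n (c H + H - 1) >= n (H - 1) (c H - 1),
and for H = 1 the left-hand side is c R by the Gauss equation. The height bound says f <= 1, so it
suffices that no function bounded above has Laplacian bounded below by a positive constant. This
follows by comparison with sqrt (1 + |x|^2), whose Laplacian is bounded: V <= 1 because h >= 0, and
c <= 2 by the height bound.
*)

theory Submission
  imports Defs
begin

section \<open>Smooth functions and directional derivatives\<close>

text \<open>The graph is entire, so everything is computed with flat derivatives on its domain. The
  induced metric is \<open>V^-2 (I - p p^T)\<close> with inverse \<open>V^2 (I + q q^T)\<close>, and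
  \<open>(c, q)\<close> is the Minkowski unit normal in the conformal picture. This fixes the
  formulas: \<open>Lap\<close> pairs the Euclidean Hessian with the inverse metric, and its
  first-order term is minus the metric trace of the Christoffel form \<open>\<Gamma>\<close>, where
  \<open>tr W = n H\<close> enters. Its coefficients are therefore bounded as soon as
  \<open>V\<close> and \<open>c\<close> are. For \<open>H > 1\<close>, \<open>c \<ge> 1\<close>
  gives \<open>(H - 1) (c H - 1) \<ge> (H - 1)^2\<close>, a positive constant, which the maximum
  principle excludes. For \<open>H = 1\<close> this constant degenerates to \<open>0\<close>, and
  the same principle yields points where \<open>c R\<close>, hence \<open>R\<close>, is small. The
  factor \<open>V\<close> on the left is harmless because \<open>0 < V \<le> 1\<close>.\<close>

definition dd :: "'a::euclidean_space \<Rightarrow> ('a \<Rightarrow> 'b::real_normed_vector) \<Rightarrow> 'a \<Rightarrow> 'b" where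
  "dd w F x = frechet_derivative F (at x) w"

lemma C_k_Suc_iff: "C_k (Suc k) f \<longleftrightarrow> (\<forall>x. f differentiable (at x)) \<and> (\<forall>v. C_k k (dd v f))"
  by (simp add: dd_def[abs_def])

lemma C_k_SucI:
  assumes "\<And>x. (f has_derivative f' x) (at x)" "\<And>v. C_k k (\<lambda>x. f' x v)"
  shows "C_k (Suc k) f"
proof -
  have "frechet_derivative f (at x) = f' x" for x
    using frechet_derivative_at[OF assms(1)] by metis
  then show ?thesis
    using assms by (auto simp: differentiable_def)
qed

text \<open>Product and chain rules leave undifferentiated factors, for which the inductions below
  need one order less than is assumed.\<close>

lemma C_k_Suc_imp: "C_k (Suc k) f \<Longrightarrow> C_k k f"
proof (induction k arbitrary: f)
  case 0
  then show ?case
    by (auto simp: continuous_on_eq_continuous_at differentiable_imp_continuous_within)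
next
  case (Suc k)
  then show ?case by (subst C_k_Suc_iff) (metis C_k_Suc_iff)
qed

lemma C_k_has_derivative: "C_k (Suc k) f \<Longrightarrow> (f has_derivative (\<lambda>v. dd v f x)) (at x)"
  by (simp add: dd_def frechet_derivative_works)

lemma C_k_const: "C_k k (\<lambda>_. c)"
proof (induction k arbitrary: c)
  case (Suc k)
  show ?case by (rule C_k_SucI[where f' = "\<lambda>_ _. 0"]) (auto simp: Suc)
qed auto

lemma C_k_add: "C_k k f \<Longrightarrow> C_k k g \<Longrightarrow> C_k k (\<lambda>x. f x + g x)"
proof (induction k arbitrary: f g)
  case (Suc k)
  show ?case
    by (rule C_k_SucI[where f' = "\<lambda>x v. dd v f x + dd v g x"])
      (use Suc in \<open>auto intro!: has_derivative_add C_k_has_derivative simp: C_k_Suc_iff simp del: C_k.simps\<close>)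
qed (auto intro: continuous_intros)

lemma C_k_bounded_linear: "bounded_linear h \<Longrightarrow> C_k k f \<Longrightarrow> C_k k (\<lambda>x. h (f x))"
proof (induction k arbitrary: f)
  case (Suc k)
  show ?case
    by (rule C_k_SucI[where f' = "\<lambda>x v. h (dd v f x)"])
      (use Suc in \<open>auto intro!: bounded_linear.has_derivative[of h] C_k_has_derivative
        simp: C_k_Suc_iff simp del: C_k.simps\<close>)
qed (auto intro: bounded_linear.continuous_on)

text \<open>The product rule gives two terms of the same shape, so one induction serves
  multiplication, scaling and the inner product.\<close>

lemma C_k_bounded_bilinear:
  assumes "bounded_bilinear h"
  shows "C_k k f \<Longrightarrow> C_k k g \<Longrightarrow> C_k k (\<lambda>x. h (f x) (g x))"
proof (induction k arbitrary: f g)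
  case 0
  then show ?case using bounded_bilinear.continuous_on[OF assms] by auto
next
  case (Suc k)
  show ?case
  proof (rule C_k_SucI)
    show "((\<lambda>x. h (f x) (g x)) has_derivative (\<lambda>v. h (f x) (dd v g x) + h (dd v f x) (g x))) (at x)" for x
      by (rule bounded_bilinear.FDERIV[OF assms]) (auto intro!: C_k_has_derivative Suc.prems)
    show "C_k k (\<lambda>x. h (f x) (dd v g x) + h (dd v f x) (g x))" for v
      using Suc.prems Suc.prems[THEN C_k_Suc_imp]
      by (intro C_k_add Suc.IH) (simp_all add: C_k_Suc_iff del: C_k.simps)
  qed
qed

lemma smooth_dd [simp, intro]: "smooth F \<Longrightarrow> smooth (dd v F)"
  by (metis C_k_Suc_iff smooth_def)

lemma smooth_has_derivative: "smooth F \<Longrightarrow> (F has_derivative (\<lambda>v. dd v F x)) (at x)"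
  using C_k_has_derivative unfolding smooth_def by blast

lemma smooth_continuous_on: "smooth F \<Longrightarrow> continuous_on S F"
  by (metis C_k.simps(1) continuous_on_subset smooth_def subset_UNIV)

text \<open>An equation between functions, not values, so that it can rewrite under a further
  \<open>dd\<close>.\<close>

lemma ddI:
  assumes "\<And>x. (F has_derivative F' x) (at x)"
  shows "dd v F = (\<lambda>x. F' x v)"
  using frechet_derivative_at[OF assms] by (metis dd_def[abs_def])

lemma smooth_const [simp]: "smooth (\<lambda>_. c)"
  by (simp add: smooth_def C_k_const)

lemma smooth_add [simp]: "smooth f \<Longrightarrow> smooth g \<Longrightarrow> smooth (\<lambda>x. f x + g x)"
  by (simp add: smooth_def C_k_add)

lemma smooth_bounded_linear: "bounded_linear h \<Longrightarrow> smooth f \<Longrightarrow> smooth (\<lambda>x. h (f x))"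
  by (simp add: smooth_def C_k_bounded_linear)

lemma smooth_bounded_bilinear:
  "bounded_bilinear h \<Longrightarrow> smooth f \<Longrightarrow> smooth g \<Longrightarrow> smooth (\<lambda>x. h (f x) (g x))"
  by (simp add: smooth_def C_k_bounded_bilinear)

lemmas smooth_mult [simp] = smooth_bounded_bilinear[OF bounded_bilinear_mult]
lemmas smooth_scaleR [simp] = smooth_bounded_bilinear[OF bounded_bilinear_scaleR]
lemmas smooth_inner [simp] = smooth_bounded_bilinear[OF bounded_bilinear_inner]
lemmas smooth_minus [simp] = smooth_bounded_linear[OF bounded_linear_minus[OF bounded_linear_ident]]

lemma smooth_diff [simp]: "smooth f \<Longrightarrow> smooth g \<Longrightarrow> smooth (\<lambda>x. f x - g x)"
  using smooth_add[of f "\<lambda>x. - g x"] by simp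

lemma smooth_sum [simp]: "(\<And>i. i \<in> I \<Longrightarrow> smooth (f i)) \<Longrightarrow> smooth (\<lambda>x. \<Sum>i\<in>I. f i x)"
  by (induction I rule: infinite_finite_induct) auto

lemma smooth_ident [simp]: "smooth (\<lambda>x. x)"
  unfolding smooth_def
proof
  show "C_k k (\<lambda>x::'a. x)" for k
    by (cases k) (simp_all add: frechet_derivative_ident C_k_const)
qed

lemma dd_const [simp]: "dd v (\<lambda>_. c) = (\<lambda>_. 0)"
  by (rule ddI) (rule has_derivative_const)

lemma dd_ident [simp]: "dd v (\<lambda>x. x) = (\<lambda>_. v)"
  by (rule ddI) (rule has_derivative_ident)

lemma dd_bounded_linear: "bounded_linear h \<Longrightarrow> smooth f \<Longrightarrow> dd v (\<lambda>x. h (f x)) = (\<lambda>x. h (dd v f x))"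
  by (rule ddI) (auto intro!: bounded_linear.has_derivative[of h] smooth_has_derivative)

lemma dd_bounded_bilinear:
  "bounded_bilinear h \<Longrightarrow> smooth f \<Longrightarrow> smooth g \<Longrightarrow>
    dd v (\<lambda>x. h (f x) (g x)) = (\<lambda>x. h (f x) (dd v g x) + h (dd v f x) (g x))"
  by (rule ddI) (auto intro!: bounded_bilinear.FDERIV smooth_has_derivative)

lemmas dd_mult [simp] = dd_bounded_bilinear[OF bounded_bilinear_mult]
lemmas dd_scaleR [simp] = dd_bounded_bilinear[OF bounded_bilinear_scaleR]
lemmas dd_inner [simp] = dd_bounded_bilinear[OF bounded_bilinear_inner]
lemmas dd_minus [simp] = dd_bounded_linear[OF bounded_linear_minus[OF bounded_linear_ident]]

lemma dd_add [simp]: "smooth f \<Longrightarrow> smooth g \<Longrightarrow> dd v (\<lambda>x. f x + g x) = (\<lambda>x. dd v f x + dd v g x)"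
  by (rule ddI) (auto intro!: has_derivative_add smooth_has_derivative)

lemma dd_diff [simp]: "smooth f \<Longrightarrow> smooth g \<Longrightarrow> dd v (\<lambda>x. f x - g x) = (\<lambda>x. dd v f x - dd v g x)"
  by (rule ddI) (auto intro!: has_derivative_diff smooth_has_derivative)

lemma dd_sum [simp]:
  "(\<And>i. i \<in> I \<Longrightarrow> smooth (f i)) \<Longrightarrow> dd v (\<lambda>x. \<Sum>i\<in>I. f i x) = (\<lambda>x. \<Sum>i\<in>I. dd v (f i) x)"
  by (rule ddI) (auto intro!: has_derivative_sum smooth_has_derivative)

lemma dd_Pair:
  "smooth f \<Longrightarrow> smooth g \<Longrightarrow> dd v (\<lambda>x. (f x, g x)) = (\<lambda>x. (dd v f x, dd v g x))"
  by (rule ddI) (auto intro!: has_derivative_Pair smooth_has_derivative)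

lemma has_derivative_real_compose:
  fixes f :: "'a::euclidean_space \<Rightarrow> real"
  assumes "(\<phi> has_real_derivative d) (at (f x))" "C_k (Suc k) f"
  shows "((\<lambda>x. \<phi> (f x)) has_derivative (\<lambda>v. d * dd v f x)) (at x)"
  using has_derivative_compose[OF C_k_has_derivative[OF assms(2)] assms(1)[unfolded has_field_derivative_def]]
  by (simp add: mult.commute)

text \<open>The derivative contains \<open>exp f\<close> itself, so the induction closes. The same
  happens for \<open>inverse\<close>; \<open>sqrt\<close> uses the latter for
  \<open>1 / (2 sqrt f)\<close>.\<close>

lemma C_k_exp:
  fixes f :: "'a::euclidean_space \<Rightarrow> real"
  shows "C_k k f \<Longrightarrow> C_k k (\<lambda>x. exp (f x))"
proof (induction k)
  case (Suc k)
  have "C_k k (\<lambda>x. exp (f x))" using Suc by (blast dest: C_k_Suc_imp)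
  moreover have "C_k k (dd v f)" for v using Suc by (simp add: C_k_Suc_iff del: C_k.simps)
  ultimately have *: "C_k k (\<lambda>x. exp (f x) * dd v f x)" for v
    by (intro C_k_bounded_bilinear[OF bounded_bilinear_mult])
  show ?case
    by (rule C_k_SucI[OF _ *]) (rule has_derivative_real_compose[OF DERIV_exp Suc.prems])
qed (auto intro: continuous_intros)

lemma C_k_inverse:
  fixes f :: "'a::euclidean_space \<Rightarrow> real"
  assumes nz: "\<And>x. f x \<noteq> 0"
  shows "C_k k f \<Longrightarrow> C_k k (\<lambda>x. inverse (f x))"
proof (induction k)
  case (Suc k)
  have "C_k k (\<lambda>x. inverse (f x))" using Suc by (blast dest: C_k_Suc_imp)
  moreover have "C_k k (dd v f)" for v using Suc by (simp add: C_k_Suc_iff del: C_k.simps)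
  ultimately have *: "C_k k (\<lambda>x. (- 1 * (inverse (f x) * inverse (f x))) * dd v f x)" for v
    by (intro C_k_bounded_bilinear[OF bounded_bilinear_mult] C_k_const)
  show ?case
  proof (rule C_k_SucI[OF _ *])
    show "((\<lambda>x. inverse (f x)) has_derivative (\<lambda>v. (- 1 * (inverse (f x) * inverse (f x))) * dd v f x)) (at x)" for x
      by (rule has_derivative_real_compose[OF _ Suc.prems])
        (use DERIV_inverse[OF nz[of x], of UNIV] in \<open>simp add: power2_eq_square numeral_2_eq_2\<close>)
  qed
qed (use nz in \<open>auto intro: continuous_intros\<close>)

lemma C_k_sqrt:
  fixes f :: "'a::euclidean_space \<Rightarrow> real"
  assumes pos: "\<And>x. f x > 0"
  shows "C_k k f \<Longrightarrow> C_k k (\<lambda>x. sqrt (f x))"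
proof (induction k)
  case (Suc k)
  have "C_k k (\<lambda>x. sqrt (f x))" using Suc by (blast dest: C_k_Suc_imp)
  then have "C_k k (\<lambda>x. inverse (sqrt (f x)))"
    using pos by (intro C_k_inverse) (auto simp: less_imp_neq[THEN not_sym])
  moreover have "C_k k (dd v f)" for v using Suc by (simp add: C_k_Suc_iff del: C_k.simps)
  ultimately have *: "C_k k (\<lambda>x. (inverse (sqrt (f x)) * (1 / 2)) * dd v f x)" for v
    by (intro C_k_bounded_bilinear[OF bounded_bilinear_mult] C_k_const)
  show ?case
  proof (rule C_k_SucI[OF _ *])
    show "((\<lambda>x. sqrt (f x)) has_derivative (\<lambda>v. (inverse (sqrt (f x)) * (1 / 2)) * dd v f x)) (at x)" for x
      by (rule has_derivative_real_compose[OF _ Suc.prems])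
        (use DERIV_real_sqrt[OF pos[of x]] in \<open>simp add: field_simps\<close>)
  qed
qed (auto intro: continuous_intros)

lemma smooth_exp [simp]: "smooth f \<Longrightarrow> smooth (\<lambda>x. exp (f x) :: real)"
  by (simp add: smooth_def C_k_exp)

lemma smooth_inverse: "smooth f \<Longrightarrow> (\<And>x. f x \<noteq> 0) \<Longrightarrow> smooth (\<lambda>x. inverse (f x) :: real)"
  by (simp add: smooth_def C_k_inverse)

lemma smooth_sqrt: "smooth f \<Longrightarrow> (\<And>x. f x > 0) \<Longrightarrow> smooth (\<lambda>x. sqrt (f x))"
  by (simp add: smooth_def C_k_sqrt)

lemma dd_real_compose:
  fixes f :: "'a::euclidean_space \<Rightarrow> real"
  assumes "\<And>x. (\<phi> has_real_derivative d x) (at (f x))" "smooth f"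
  shows "dd v (\<lambda>x. \<phi> (f x)) = (\<lambda>x. d x * dd v f x)"
  by (rule ddI) (use assms in \<open>auto simp: smooth_def intro: has_derivative_real_compose\<close>)

lemma dd_exp: "smooth f \<Longrightarrow> dd v (\<lambda>x. exp (f x) :: real) = (\<lambda>x. exp (f x) * dd v f x)"
  by (rule dd_real_compose) (rule DERIV_exp)

section \<open>Linearity in the direction and symmetry of second derivatives\<close>

lemma dd_linear: "smooth F \<Longrightarrow> linear (\<lambda>v. dd v F x)"
  using has_derivative_linear smooth_has_derivative by blast

lemma dd_add_dir: "smooth F \<Longrightarrow> dd (v + w) F x = dd v F x + dd w F x"
  using linear_add[OF dd_linear] by metis

lemma dd_scaleR_dir: "smooth F \<Longrightarrow> dd (r *\<^sub>R v) F x = r *\<^sub>R dd v F x"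
  using linear_scale[OF dd_linear] by metis

lemma dd_eq_sum_Basis: "smooth F \<Longrightarrow> dd v F x = (\<Sum>b\<in>Basis. (v \<bullet> b) *\<^sub>R dd b F x)"
  using linear_sum[OF dd_linear[of F x], of "\<lambda>b. (v \<bullet> b) *\<^sub>R b" Basis]
  by (simp add: euclidean_representation dd_scaleR_dir)

lemma smooth_along_line:
  fixes F :: "'a::euclidean_space \<Rightarrow> real"
  assumes "smooth F"
  shows "((\<lambda>t. F (x + t *\<^sub>R w)) has_real_derivative dd w F (x + t *\<^sub>R w)) (at t within S)"
proof -
  have "((\<lambda>t. x + t *\<^sub>R w) has_derivative (\<lambda>t. t *\<^sub>R w)) (at t within S)"
    by (auto intro!: derivative_eq_intros)
  from has_derivative_compose[OF this smooth_has_derivative[OF assms]]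
  show ?thesis
    by (simp add: dd_scaleR_dir assms has_field_derivative_def mult.commute[of _ "dd w F (x + t *\<^sub>R w)"])
qed

text \<open>The mean value theorem is applied along \<open>v\<close> to the difference of
  \<open>F\<close> and its translate by \<open>h w\<close>, then along \<open>w\<close> to
  \<open>dd v F\<close>. The second difference is symmetric in \<open>v\<close> and
  \<open>w\<close>, which drives Schwarz's theorem.\<close>

lemma second_difference_mean_value:
  fixes F :: "'a::euclidean_space \<Rightarrow> real"
  assumes "smooth F" "h > 0"
  obtains s t where "0 < s" "s < h" "0 < t" "t < h"
    "F (x + h *\<^sub>R v + h *\<^sub>R w) - F (x + h *\<^sub>R v) - F (x + h *\<^sub>R w) + F x
      = h * h * dd w (dd v F) (x + s *\<^sub>R v + t *\<^sub>R w)"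
proof -
  let ?\<phi> = "\<lambda>s. F ((x + h *\<^sub>R w) + s *\<^sub>R v) - F (x + s *\<^sub>R v)"
  have "\<exists>s>0. s < h \<and> ?\<phi> h - ?\<phi> 0 = (h - 0) * (dd v F ((x + h *\<^sub>R w) + s *\<^sub>R v) - dd v F (x + s *\<^sub>R v))"
    by (rule MVT2[OF \<open>h > 0\<close>]) (auto intro!: DERIV_diff smooth_along_line assms)
  then obtain s where s: "0 < s" "s < h"
    "?\<phi> h - ?\<phi> 0 = h * (dd v F ((x + h *\<^sub>R w) + s *\<^sub>R v) - dd v F (x + s *\<^sub>R v))" by auto
  let ?\<chi> = "\<lambda>t. dd v F ((x + s *\<^sub>R v) + t *\<^sub>R w)"
  have "\<exists>t>0. t < h \<and> ?\<chi> h - ?\<chi> 0 = (h - 0) * dd w (dd v F) ((x + s *\<^sub>R v) + t *\<^sub>R w)"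
    by (rule MVT2[OF \<open>h > 0\<close>]) (auto intro!: smooth_along_line assms)
  then obtain t where t: "0 < t" "t < h" "?\<chi> h - ?\<chi> 0 = h * dd w (dd v F) ((x + s *\<^sub>R v) + t *\<^sub>R w)" by auto
  show thesis
    by (rule that[OF s(1,2) t(1,2)]) (use s(3) t(3) in \<open>simp add: algebra_simps\<close>)
qed

lemma dd_commute_real:
  fixes F :: "'a::euclidean_space \<Rightarrow> real"
  assumes F: "smooth F"
  shows "dd w (dd v F) x = dd v (dd w F) x"
proof (rule ccontr)
  let ?A = "dd w (dd v F)" and ?B = "dd v (dd w F)"
  assume "?A x \<noteq> ?B x"
  define e where "e = \<bar>?A x - ?B x\<bar> / 2"
  have e: "e > 0" using \<open>?A x \<noteq> ?B x\<close> by (simp add: e_def)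
  have cont: "isCont ?A x" "isCont ?B x"
    using smooth_continuous_on[of ?A UNIV] smooth_continuous_on[of ?B UNIV] F
    by (auto simp: continuous_on_eq_continuous_at)
  obtain d1 where d1: "d1 > 0" "\<And>y. dist y x < d1 \<Longrightarrow> dist (?A y) (?A x) < e"
    using cont(1) e unfolding continuous_at_eps_delta by metis
  obtain d2 where d2: "d2 > 0" "\<And>y. dist y x < d2 \<Longrightarrow> dist (?B y) (?B x) < e"
    using cont(2) e unfolding continuous_at_eps_delta by metis
  \<comment> \<open>Small enough to keep all intermediate points in both continuity balls; the
    \<open>+ 1\<close> keeps the denominator positive and the estimate strict.\<close>
  define h where "h = min d1 d2 / (norm v + norm w + 1)"
  have h: "h > 0" using d1 d2 by (auto simp: h_def intro!: divide_pos_pos add_nonneg_pos)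
  have close: "dist (x + s *\<^sub>R v + t *\<^sub>R w) x < min d1 d2" if "0 < s" "s < h" "0 < t" "t < h" for s t
  proof -
    have "dist (x + s *\<^sub>R v + t *\<^sub>R w) x \<le> s * norm v + t * norm w"
      using norm_triangle_ineq[of "s *\<^sub>R v" "t *\<^sub>R w"] that by (simp add: dist_norm add.assoc)
    also have "\<dots> \<le> h * norm v + h * norm w"
      using that by (intro add_mono mult_right_mono) auto
    also have "\<dots> < h * (norm v + norm w + 1)" using h by (simp add: algebra_simps)
    also have "\<dots> = min d1 d2"
      by (simp add: h_def add_nonneg_eq_0_iff)
    finally show ?thesis .
  qed
  obtain s t where st: "0 < s" "s < h" "0 < t" "t < h"
    "F (x + h *\<^sub>R v + h *\<^sub>R w) - F (x + h *\<^sub>R v) - F (x + h *\<^sub>R w) + F x = h * h * ?A (x + s *\<^sub>R v + t *\<^sub>R w)"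
    using second_difference_mean_value[OF F h] by blast
  obtain s' t' where st': "0 < s'" "s' < h" "0 < t'" "t' < h"
    "F (x + h *\<^sub>R w + h *\<^sub>R v) - F (x + h *\<^sub>R w) - F (x + h *\<^sub>R v) + F x = h * h * ?B (x + s' *\<^sub>R w + t' *\<^sub>R v)"
    using second_difference_mean_value[OF F h] by blast
  have "?A (x + s *\<^sub>R v + t *\<^sub>R w) = ?B (x + t' *\<^sub>R v + s' *\<^sub>R w)"
    using st(5) st'(5) h by (simp add: algebra_simps)
  moreover have "dist (?A (x + s *\<^sub>R v + t *\<^sub>R w)) (?A x) < e"
    using d1(2) close[OF st(1-4)] by simp
  moreover have "dist (?B (x + t' *\<^sub>R v + s' *\<^sub>R w)) (?B x) < e"
    using d2(2) close[OF st'(3,4,1,2)] by simp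
  ultimately show False by (simp add: e_def dist_real_def abs_if field_simps split: if_splits)
qed

lemma dd_commute:
  fixes F :: "'a::euclidean_space \<Rightarrow> 'b::euclidean_space"
  assumes F: "smooth F"
  shows "dd w (dd v F) = dd v (dd w F)"
proof (rule ext, rule euclidean_eqI)
  fix x and b :: 'b
  have "dd w (dd v (\<lambda>x. F x \<bullet> b)) x = dd v (dd w (\<lambda>x. F x \<bullet> b)) x"
    by (rule dd_commute_real) (use F in simp)
  then show "dd w (dd v F) x \<bullet> b = dd v (dd w F) x \<bullet> b"
    using F by simp
qed

section \<open>Traces\<close>

lemma lin_trace_linear_inner:
  assumes "linear f"
  shows "(\<Sum>b\<in>Basis. (w \<bullet> b) * (f b \<bullet> z)) = f w \<bullet> z"
proof -
  have "f w = f (\<Sum>b\<in>Basis. (w \<bullet> b) *\<^sub>R b)" by (simp add: euclidean_representation)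
  also have "\<dots> = (\<Sum>b\<in>Basis. (w \<bullet> b) *\<^sub>R f b)"
    by (simp add: linear_sum[OF assms] linear_scale[OF assms])
  finally show ?thesis by (simp add: inner_sum_left)
qed

lemma lin_trace_mult_commute:
  assumes "linear f" "linear h"
  shows "lin_trace (\<lambda>v. f (h v)) = lin_trace (\<lambda>v. h (f v))"
proof -
  have "lin_trace (\<lambda>v. f (h v)) = (\<Sum>b\<in>Basis. \<Sum>j\<in>Basis. (h b \<bullet> j) * (f j \<bullet> b))"
    by (simp add: lin_trace_def lin_trace_linear_inner[OF assms(1)])
  also have "\<dots> = (\<Sum>j\<in>Basis. \<Sum>b\<in>Basis. (f j \<bullet> b) * (h b \<bullet> j))"
    by (subst sum.swap) (simp add: mult.commute)
  also have "\<dots> = lin_trace (\<lambda>v. h (f v))"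
    by (simp add: lin_trace_def lin_trace_linear_inner[OF assms(2)])
  finally show ?thesis .
qed

text \<open>Cauchy-Schwarz for the diagonal against the constant \<open>1\<close>; symmetry turns
  \<open>M b \<bullet> M b\<close> into a diagonal entry of the square.\<close>

lemma lin_trace_square_symmetric_ge:
  fixes M :: "'a::euclidean_space \<Rightarrow> 'a"
  assumes "\<And>v w. M v \<bullet> w = v \<bullet> M w"
  shows "(lin_trace M)\<^sup>2 \<le> DIM('a) * lin_trace (\<lambda>v. M (M v))"
proof -
  have "(lin_trace M)\<^sup>2 = (\<Sum>b\<in>Basis. 1 * (M b \<bullet> b))\<^sup>2" by (simp add: lin_trace_def)
  also have "\<dots> \<le> (\<Sum>b\<in>(Basis::'a set). 1\<^sup>2) * (\<Sum>b\<in>Basis. (M b \<bullet> b)\<^sup>2)"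
    by (rule Cauchy_Schwarz_ineq_sum)
  also have "\<dots> \<le> DIM('a) * (\<Sum>b\<in>Basis. M b \<bullet> M b)"
  proof -
    have "(M b \<bullet> b)\<^sup>2 \<le> M b \<bullet> M b" if "b \<in> Basis" for b
      using Cauchy_Schwarz_ineq[of "M b" b] that by simp
    then show ?thesis by (simp add: mult_left_mono sum_mono)
  qed
  also have "\<dots> = DIM('a) * lin_trace (\<lambda>v. M (M v))"
    by (simp add: lin_trace_def assms)
  finally show ?thesis .
qed

text \<open>\<open>I + q q\<^sup>T\<close> is the square of \<open>I + \<kappa> q q\<^sup>T\<close> with \<open>\<kappa> = 1 / (1 + sqrt (1 + |q|\<^sup>2))\<close>, so the operator below
  is similar to a symmetric one.\<close>

lemma lin_trace_square_rank_one_ge: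
  fixes G :: "'a::euclidean_space \<Rightarrow> 'a"
  assumes "linear G" and sym: "\<And>v w. G v \<bullet> w = v \<bullet> G w"
    and W: "\<And>v. W v = r *\<^sub>R (G v + (q \<bullet> G v) *\<^sub>R q)"
  shows "(lin_trace W)\<^sup>2 \<le> DIM('a) * lin_trace (\<lambda>v. W (W v))"
proof -
  define c where "c = sqrt (1 + q \<bullet> q)"
  define k where "k = 1 / (1 + c)"
  define B where "B v = v + (k * (q \<bullet> v)) *\<^sub>R q" for v
  have c: "c \<ge> 0" "q \<bullet> q = (c - 1) * (c + 1)" by (auto simp: c_def algebra_simps)
  \<comment> \<open>Exactly the condition for \<open>B\<close> to square to
    \<open>I + q q^T\<close>.\<close>
  have k: "2 * k + k * k * (q \<bullet> q) = 1"
  proof -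
    have "(1 + c) * (1 + c) * (2 * k + k * k * (q \<bullet> q)) = 2 * (1 + c) + q \<bullet> q"
      using c(1) by (simp add: k_def divide_simps)
    also have "\<dots> = (1 + c) * (1 + c) * 1" unfolding c(2) by (simp add: algebra_simps)
    finally show ?thesis using c(1) by simp
  qed
  have BB: "B (B v) = v + (q \<bullet> v) *\<^sub>R q" for v
  proof -
    have "B (B v) = v + (k * (q \<bullet> v) + k * (q \<bullet> v + k * (q \<bullet> v) * (q \<bullet> q))) *\<^sub>R q"
      by (simp add: B_def inner_add_right scaleR_add_left)
    also have "k * (q \<bullet> v) + k * (q \<bullet> v + k * (q \<bullet> v) * (q \<bullet> q)) = (2 * k + k * k * (q \<bullet> q)) * (q \<bullet> v)"
      by (simp add: algebra_simps)
    finally show ?thesis by (simp add: k)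
  qed
  have linB: "linear B" by (rule linearI) (simp_all add: B_def algebra_simps)
  have symB: "B v \<bullet> w = v \<bullet> B w" for v w
    by (simp add: B_def inner_add_left inner_add_right inner_commute)
  \<comment> \<open>\<open>W\<close> is \<open>r B B G\<close>; cyclicity of the trace moves one
    \<open>B\<close> to the right, giving the symmetric \<open>r B G B\<close> with the same
    traces.\<close>
  define M where "M v = r *\<^sub>R B (G (B v))" for v
  have WB: "W v = r *\<^sub>R B (B (G v))" for v by (simp add: W BB)
  note lin = linear_compose[unfolded o_def]
  have lG: "linear (\<lambda>v. r *\<^sub>R B (G v))"
    by (intro linear_compose_scale_right lin[OF \<open>linear G\<close> linB])
  have lW: "linear W" unfolding WB[abs_def]
    by (intro linear_compose_scale_right lin[OF _ linB] \<open>linear G\<close>)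
  have "lin_trace W = lin_trace M"
    using lin_trace_mult_commute[OF linB lG]
    by (simp add: WB[abs_def] M_def[abs_def] linear_scale[OF linB])
  moreover have "lin_trace (\<lambda>v. W (W v)) = lin_trace (\<lambda>v. M (M v))"
    using lin_trace_mult_commute[OF linB lin[OF lW lG]]
    by (simp add: WB[abs_def] M_def[abs_def] linear_scale[OF linB] linear_scale[OF \<open>linear G\<close>])
  ultimately show ?thesis
    using lin_trace_square_symmetric_ge[of M] by (simp add: M_def symB sym)
qed

section \<open>The geometry of a spacelike graph\<close>

text \<open>In the coordinate \<open>V = exp (- t)\<close> the Steady State space is the half space \<open>V > 0\<close> of Minkowski space
  with the metric multiplied by \<open>V\<^sup>- \<^sup>2\<close>. The vector \<open>p\<close> is the Euclidean gradient of \<open>V\<close> along the graph,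
  \<open>c\<close> is \<open>cosh \<theta>\<close>, \<open>W\<close> is minus the shape operator
  and \<open>T / V\<close> its bilinear form.\<close>

locale spacelike_graph =
  fixes u :: "'a::euclidean_space \<Rightarrow> real"
  assumes smooth_u [simp]: "smooth u"
    and spacelike: "v \<noteq> 0 \<Longrightarrow> (dd v u x)\<^sup>2 < exp (2 * u x) * (v \<bullet> v)"
begin

definition "V x = exp (- u x)"
definition "p x = (\<Sum>b\<in>Basis. dd b V x *\<^sub>R b)"
definition "c x = inverse (sqrt (1 - p x \<bullet> p x))"
text \<open>The spatial part of the Minkowski unit normal; \<open>I + q q^T\<close> inverts
  \<open>I - p p^T\<close>.\<close>

definition "q x = c x *\<^sub>R p x"
definition "W x v = c x *\<^sub>R v - V x *\<^sub>R dd v q x"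
definition "gm x v w = exp (2 * u x) * (v \<bullet> w) - dd v u x * dd w u x"
definition "T x v w = c x * exp (u x) * (v \<bullet> w - (v \<bullet> p x) * (w \<bullet> p x) - V x * (dd v p x \<bullet> w))"
text \<open>Spatial component of the Gauss formula: the first two terms are the ambient Christoffel
  form, and the last removes the normal part, whose coefficient is \<open>T / V\<close> while the
  unit normal has spatial component \<open>- V q\<close>.\<close>

definition "\<Gamma> x v w = dd v u x *\<^sub>R w + dd w u x *\<^sub>R v + T x v w *\<^sub>R q x"

section \<open>First derivatives of the graph function\<close>

lemma V_pos [simp]: "V x > 0" and V_nz [simp]: "V x \<noteq> 0"
  by (simp_all add: V_def)

lemma exp_u: "exp (u x) = 1 / V x" "exp (2 * u x) = 1 / (V x * V x)"
  by (simp_all add: V_def exp_minus divide_inverse exp_double power2_eq_square)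

lemma smooth_V [simp]: "smooth V"
  unfolding V_def[abs_def] by simp

lemma smooth_p [simp]: "smooth p"
  unfolding p_def[abs_def] by simp

lemma dd_V: "dd v V x = v \<bullet> p x"
proof -
  have "dd v V x = (\<Sum>b\<in>Basis. (v \<bullet> b) *\<^sub>R dd b V x)" by (simp add: dd_eq_sum_Basis)
  then show ?thesis by (simp add: p_def inner_sum_right mult.commute)
qed

lemma dd_V_fun [simp]: "dd v V = (\<lambda>x. v \<bullet> p x)"
  by (rule ext) (rule dd_V)

lemma dd_u: "dd v u = (\<lambda>x. - exp (u x) * (v \<bullet> p x))"
proof
  fix x
  have "dd v V x = - (V x * dd v u x)"
    unfolding V_def[abs_def] by (subst dd_exp) simp_all
  then show "dd v u x = - exp (u x) * (v \<bullet> p x)"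
    unfolding dd_V exp_u by (simp add: field_simps)
qed

lemma dd_exp_u: "dd v (\<lambda>x. exp (u x)) = (\<lambda>x. - exp (u x) * exp (u x) * (v \<bullet> p x))"
  by (simp add: dd_exp dd_u mult.assoc)

lemma norm_p_less_1: "p x \<bullet> p x < 1"
proof (cases "p x = 0")
  case False
  \<comment> \<open>Spacelikeness is tested in the direction \<open>p x\<close> itself.\<close>
  then show ?thesis using spacelike[OF False, of x]
    by (simp add: dd_u exp_u power2_eq_square divide_simps)
qed simp

lemma c_pos [simp]: "c x > 0" and c_nz [simp]: "c x \<noteq> 0"
  using norm_p_less_1[of x] by (simp_all add: c_def)

lemma c_square: "c x * c x * (1 - p x \<bullet> p x) = 1"
  using norm_p_less_1[of x] by (simp add: c_def field_simps)

lemma p_inner_p: "p x \<bullet> p x = 1 - 1 / (c x * c x)"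
proof -
  have "1 - p x \<bullet> p x = 1 / (c x * c x)"
    using c_square[of x] by (simp add: nonzero_eq_divide_eq mult.commute)
  then show ?thesis by simp
qed

lemma q_inner_q: "q x \<bullet> q x = c x * c x - 1"
  by (simp add: q_def p_inner_p field_simps)

lemma c_ge_1: "c x \<ge> 1"
proof -
  have "1 \<le> (c x)\<^sup>2" using q_inner_q[of x] inner_ge_zero[of "q x"] by (simp add: power2_eq_square)
  then show ?thesis by (rule power2_le_imp_le[of 1, simplified]) (simp add: less_imp_le)
qed

lemma smooth_c [simp]: "smooth c"
  unfolding c_def[abs_def] using norm_p_less_1
  by (intro smooth_inverse smooth_sqrt smooth_diff) (auto simp: less_imp_neq)

lemma smooth_q [simp]: "smooth q"
  unfolding q_def[abs_def] by simp

lemma dd_p_symmetric: "dd v p x \<bullet> w = dd w p x \<bullet> v"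
  using fun_cong[OF dd_commute[OF smooth_V, of v w], of x] by (simp add: inner_commute)

text \<open>Obtained by differentiating the identity \<open>c_square\<close>, which avoids the
  derivative of the root.\<close>

lemma dd_c: "dd v c = (\<lambda>x. c x * c x * c x * (p x \<bullet> dd v p x))"
proof
  fix x
  have "dd v (\<lambda>x. c x * c x * (1 - p x \<bullet> p x)) x = 0"
    by (simp only: c_square) simp
  then have "2 * c x * (dd v c x * (1 - p x \<bullet> p x)) = 2 * c x * (c x * (p x \<bullet> dd v p x))"
    by (simp add: inner_commute algebra_simps)
  then have "dd v c x * (1 - p x \<bullet> p x) = c x * (p x \<bullet> dd v p x)" by simp
  then have "c x * c x * (dd v c x * (1 - p x \<bullet> p x)) = c x * c x * (c x * (p x \<bullet> dd v p x))" by simp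
  moreover have "c x * c x * (dd v c x * (1 - p x \<bullet> p x)) = dd v c x * (c x * c x * (1 - p x \<bullet> p x))"
    by (simp only: mult.assoc mult.commute mult.left_commute)
  ultimately show "dd v c x = c x * c x * c x * (p x \<bullet> dd v p x)"
    by (simp add: c_square)
qed

lemma dd_q: "dd v q x = c x *\<^sub>R (dd v p x + (q x \<bullet> dd v p x) *\<^sub>R q x)"
proof -
  have "dd v q x = c x *\<^sub>R dd v p x + dd v c x *\<^sub>R p x"
    unfolding q_def[abs_def] by simp
  also have "dd v c x *\<^sub>R p x = c x *\<^sub>R ((q x \<bullet> dd v p x) *\<^sub>R q x)"
    by (simp add: dd_c q_def mult.assoc mult.left_commute)
  finally show ?thesis by (simp add: scaleR_add_right)
qed

text \<open>This is the derivative of \<open>q \<bullet> q = c^2 - 1\<close> divided by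
  \<open>2 c\<close>.\<close>

lemma dd_c_eq: "dd v c x = p x \<bullet> dd v q x"
proof -
  have "p x \<bullet> dd v q x = c x * (p x \<bullet> dd v p x) * (1 + c x * c x * (p x \<bullet> p x))"
    by (simp add: dd_q q_def inner_add_right distrib_left mult.assoc mult.left_commute)
  also have "c x * c x * (p x \<bullet> p x) = c x * c x - 1"
    using c_square[of x] by (simp add: right_diff_distrib)
  finally show ?thesis by (simp add: dd_c mult.assoc mult.left_commute)
qed

section \<open>The shape operator, its bilinear form and the Codazzi equation\<close>

lemma linear_dd_p: "linear (\<lambda>v. dd v p x)"
  by (simp add: dd_linear)

lemma linear_dd_q: "linear (\<lambda>v. dd v q x)"
  by (simp add: dd_linear)

text \<open>The Euclidean Hessian of \<open>(|x|^2 - V^2) / 2\<close>, hence symmetric.\<close>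

definition "G x v = v - (v \<bullet> p x) *\<^sub>R p x - V x *\<^sub>R dd v p x"

lemma linear_G: "linear (G x)"
  by (rule linearI)
    (simp_all add: G_def dd_add_dir dd_scaleR_dir algebra_simps)

lemma G_symmetric: "G x v \<bullet> w = v \<bullet> G x w"
  using dd_p_symmetric[of v x w]
  by (simp add: G_def inner_diff_left inner_diff_right inner_commute)

text \<open>\<open>I + q q^T\<close> cancels \<open>I - p p^T\<close> in \<open>G\<close>, and
  \<open>dd_q\<close> says that the derivative of \<open>q\<close> is \<open>c (I + q q^T)\<close>
  applied to that of \<open>p\<close>.\<close>

lemma W_eq_G: "W x v = c x *\<^sub>R (G x v + (q x \<bullet> G x v) *\<^sub>R q x)"
proof -
  have "(q x \<bullet> v - (v \<bullet> p x) * (q x \<bullet> p x)) *\<^sub>R q x = (v \<bullet> p x) *\<^sub>R p x"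
    by (simp add: q_def p_inner_p inner_commute[of v] field_simps)
  then have "(q x \<bullet> G x v) *\<^sub>R q x = (v \<bullet> p x) *\<^sub>R p x - (V x * (q x \<bullet> dd v p x)) *\<^sub>R q x"
    unfolding G_def inner_diff_right by (simp add: algebra_simps)
  then show ?thesis by (simp add: W_def dd_q G_def algebra_simps)
qed

lemma trace_W_square_ge: "(lin_trace (W x))\<^sup>2 \<le> DIM('a) * lin_trace (\<lambda>v. W x (W x v))"
  by (rule lin_trace_square_rank_one_ge[OF linear_G G_symmetric W_eq_G])

lemma T_eq_G: "T x v w = c x / V x * (G x v \<bullet> w)"
  by (simp add: T_def exp_u G_def inner_diff_left inner_commute[of "p x"])

lemma T_symmetric: "T x v w = T x w v"
  using G_symmetric[of x v w] by (simp add: T_eq_G inner_commute)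

lemma gm_eq: "gm x v w = (v \<bullet> w - (v \<bullet> p x) * (w \<bullet> p x)) / (V x * V x)"
  by (simp add: gm_def exp_u dd_u divide_simps)

text \<open>The metric \<open>V^-2 (I - p p^T)\<close> cancels the factor \<open>I + q q^T\<close>
  of \<open>W_eq_G\<close>, leaving \<open>c V^-2 G\<close>.\<close>

lemma gm_W: "gm x (W x v) w = T x v w / V x"
proof -
  have "p x \<bullet> W x v = p x \<bullet> G x v * c x * (c x * c x)"
    unfolding W_eq_G by (simp add: q_def inner_add_right p_inner_p field_simps)
  moreover have "W x v \<bullet> w = c x * (G x v \<bullet> w + (c x * c x) * ((p x \<bullet> G x v) * (p x \<bullet> w)))"
    unfolding W_eq_G by (simp add: q_def inner_add_left algebra_simps)
  ultimately show ?thesis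
    by (simp add: gm_eq T_eq_G inner_commute[of _ "p x"] field_simps)
qed

text \<open>The right-hand side is minus the logarithmic derivative of \<open>c exp u\<close>, the
  factor in front of the Hessian in \<open>T\<close>.\<close>

lemma T_q: "T x v (q x) = exp (u x) * (v \<bullet> p x) - c x * c x * (p x \<bullet> dd v p x)"
proof -
  have "T x v (q x) = (c x * c x * (1 - p x \<bullet> p x)) * (exp (u x) * (v \<bullet> p x))
      - exp (u x) * V x * (c x * c x * (p x \<bullet> dd v p x))"
    unfolding T_def q_def by (simp add: inner_commute algebra_simps)
  then show ?thesis unfolding c_square exp_u by simp
qed

text \<open>\<open>T\<close> is the factor \<open>A = c exp u\<close> times a Hessian
  \<open>B\<close>. Third derivatives commute, so only derivatives of \<open>A\<close> survive, and
  these are given by \<open>T_q\<close>.\<close>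

lemma dd_T_codazzi:
  "dd v (\<lambda>x. T x w z) x - dd w (\<lambda>x. T x v z) x + T x w z * T x v (q x) - T x v z * T x w (q x) = 0"
proof -
  define A where "A x = c x * exp (u x)" for x
  define B where "B w z x = w \<bullet> z - (w \<bullet> p x) * (z \<bullet> p x) - V x * (dd w p x \<bullet> z)" for w z x
  have sm: "smooth A" "smooth (B w z)" for w z
    by (simp_all add: A_def[abs_def] B_def[abs_def])
  have T: "T x w z = A x * B w z x" for w z x
    by (simp add: T_def A_def B_def)
  have A: "dd v A x = - T x v (q x) * A x" for v
    unfolding T_q A_def[abs_def] by (simp add: dd_exp_u dd_c algebra_simps)
  have B: "dd v (B w z) x = dd w (B v z) x"
    unfolding B_def[abs_def] using dd_p_symmetric[of v x w]
    by (simp add: dd_commute[of p v w] inner_commute algebra_simps)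
  show ?thesis
    unfolding T[abs_def] using B by (simp add: sm A) (simp add: T algebra_simps)
qed

lemma smooth_T [simp]: "smooth (\<lambda>x. T x v w)"
  by (simp add: T_def[abs_def])

section \<open>The Levi-Civita connection of the induced metric\<close>

lemma dd_u_q: "dd (q x) u x = - exp (u x) * (c x - 1 / c x)"
  by (simp add: dd_u q_def p_inner_p algebra_simps)

lemma dd_dd_u: "dd v (dd w u) x = exp (u x) * (exp (u x) * (v \<bullet> p x) * (w \<bullet> p x) - dd v p x \<bullet> w)"
  by (subst dd_u) (simp add: dd_exp_u inner_commute algebra_simps)

lemma T_eq_u: "T x v w = c x * V x * (exp (2 * u x) * (v \<bullet> w) + dd v (dd w u) x - 2 * dd v u x * dd w u x)"
  unfolding T_def dd_dd_u unfolding dd_u exp_u by (simp add: field_simps)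

text \<open>The candidate \<open>\<Gamma>\<close> is tested against every \<open>z\<close>, so the
  metric need not be inverted; \<open>T_eq_u\<close> matches the two sides.\<close>

lemma gm_koszul:
  "(dd v (\<lambda>x. gm x w z) x + dd w (\<lambda>x. gm x v z) x - dd z (\<lambda>x. gm x v w) x) / 2 = gm x (\<Gamma> x v w) z"
proof -
  have e: "dd v (\<lambda>x. exp (2 * u x)) x = 2 * exp (2 * u x) * dd v u x" for v
    by (subst dd_exp) simp_all
  have com: "dd z (dd v u) x = dd v (dd z u) x" "dd z (dd w u) x = dd w (dd z u) x"
      "dd w (dd v u) x = dd v (dd w u) x"
    by (simp_all add: fun_cong[OF dd_commute[OF smooth_u]])
  have 1: "(dd v (\<lambda>x. gm x w z) x + dd w (\<lambda>x. gm x v z) x - dd z (\<lambda>x. gm x v w) x) / 2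
     = exp (2 * u x) * (dd v u x * (w \<bullet> z) + dd w u x * (v \<bullet> z) - dd z u x * (v \<bullet> w))
       - dd v (dd w u) x * dd z u x"
    unfolding gm_def by (simp add: e com) (simp add: algebra_simps)
  have u\<Gamma>: "dd (\<Gamma> x v w) u x = 2 * dd v u x * dd w u x - T x v w * exp (u x) * (c x - 1 / c x)"
    unfolding \<Gamma>_def by (simp add: dd_add_dir dd_scaleR_dir dd_u_q)
  have qz: "exp (2 * u x) * (q x \<bullet> z) = - c x * exp (u x) * dd z u x"
    by (simp add: q_def dd_u exp_u inner_commute)
  have "gm x (\<Gamma> x v w) z = exp (2 * u x) * (dd v u x * (w \<bullet> z) + dd w u x * (v \<bullet> z))
      + T x v w * (exp (2 * u x) * (q x \<bullet> z)) - dd (\<Gamma> x v w) u x * dd z u x"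
    by (simp add: gm_def \<Gamma>_def inner_add_left algebra_simps)
  also have "\<dots> = exp (2 * u x) * (dd v u x * (w \<bullet> z) + dd w u x * (v \<bullet> z))
      - dd z u x * (T x v w * exp (u x) / c x + 2 * dd v u x * dd w u x)"
    unfolding u\<Gamma> qz by (simp add: algebra_simps)
  also have "T x v w * exp (u x) / c x
      = exp (2 * u x) * (v \<bullet> w) + dd v (dd w u) x - 2 * dd v u x * dd w u x"
    unfolding T_eq_u exp_u(1) by simp
  finally show ?thesis unfolding 1 by (simp add: algebra_simps)
qed

lemma gm_pos: "v \<noteq> 0 \<Longrightarrow> gm x v v > 0"
  using spacelike[of v x] by (simp add: gm_def power2_eq_square)

lemma gm_diff_left: "gm x (v - w) z = gm x v z - gm x w z"
  by (simp add: gm_def inner_diff_left linear_diff[OF dd_linear[OF smooth_u]] algebra_simps)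

lemma sharp_gm: "(\<And>z. gm x y z = \<phi> z) \<Longrightarrow> sharp gm x \<phi> = y"
  unfolding sharp_def
proof (rule the_equality)
  assume y: "\<And>z. gm x y z = \<phi> z"
  then show "\<forall>z. gm x y z = \<phi> z" by blast
  fix y' assume "\<forall>z. gm x y' z = \<phi> z"
  then have "gm x (y' - y) (y' - y) = 0" by (simp add: gm_diff_left y)
  then show "y' = y" using gm_pos[of "y' - y" x] by force
qed

lemma christoffel_gm: "christoffel gm x v w = \<Gamma> x v w"
  unfolding christoffel_def by (rule sharp_gm) (simp add: gm_koszul[symmetric] dd_def)

lemma cov_deriv_gm: "cov_deriv gm Y x v = dd v Y x + \<Gamma> x v (Y x)"
  by (simp add: cov_deriv_along_def christoffel_gm dd_def frechet_derivative_ident)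

section \<open>Riemann, Ricci and scalar curvature\<close>

lemma linear_T: "linear (T x v)"
  by (rule linearI) (simp_all add: T_eq_G inner_add_right algebra_simps)

text \<open>The Gauss equation in the ambient space of constant curvature 1.\<close>

lemma riemann_curvature_gm:
  "riemann_curvature gm x v w z = (gm x w z) *\<^sub>R v - (gm x v z) *\<^sub>R w
     - (T x w z / V x) *\<^sub>R W x v + (T x v z / V x) *\<^sub>R W x w"
proof -
  \<comment> \<open>The coefficient left on the undifferentiated vectors once the terms in
    \<open>q\<close> cancel. Its part \<open>- T c / V\<close> combines with \<open>T\<close> times
    the derivative of \<open>q\<close> to \<open>- (T / V) W\<close>.\<close>
  define C where "C v w = dd v u x * dd w u x - dd v (dd w u) x + T x v w * dd (q x) u x" for v w
  have dd\<Gamma>: "dd v (\<lambda>x. \<Gamma> x w z) x = dd v (dd w u) x *\<^sub>R z + dd v (dd z u) x *\<^sub>R w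
      + T x w z *\<^sub>R dd v q x + dd v (\<lambda>x. T x w z) x *\<^sub>R q x" for v w z
    unfolding \<Gamma>_def by (simp add: add.assoc)
  have u\<Gamma>: "dd (\<Gamma> x w z) u x = dd w u x * dd z u x + dd w u x * dd z u x + T x w z * dd (q x) u x" for w z
    unfolding \<Gamma>_def by (simp add: dd_add_dir dd_scaleR_dir)
  have T\<Gamma>: "T x v (\<Gamma> x w z) = dd w u x * T x v z + dd z u x * T x v w + T x w z * T x v (q x)" for v w z
    unfolding \<Gamma>_def by (simp add: linear_add[OF linear_T] linear_scale[OF linear_T])
  have com: "dd w (dd v u) x = dd v (dd w u) x" by (simp add: fun_cong[OF dd_commute[OF smooth_u]])
  have cod: "dd v (\<lambda>x. T x w z) x = dd w (\<lambda>x. T x v z) x - T x w z * T x v (q x) + T x v z * T x w (q x)"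
    using dd_T_codazzi[where v=v and w=w and z=z and x=x] by simp
  have C: "C v z = gm x v z - T x v z * c x / V x" for v z
  proof -
    have "T x v z * dd (q x) u x = - (T x v z * c x / V x) + T x v z * exp (u x) / c x"
      unfolding dd_u_q by (simp add: exp_u algebra_simps)
    also have "T x v z * exp (u x) / c x = exp (2 * u x) * (v \<bullet> z) + dd v (dd z u) x - 2 * dd v u x * dd z u x"
      unfolding T_eq_u exp_u(1) by simp
    finally show ?thesis by (simp add: C_def gm_def)
  qed
  have double: "(2 * a) *\<^sub>R y = a *\<^sub>R y + a *\<^sub>R y" for a and y :: 'a
    by (metis mult_2 scaleR_add_left)
  have "riemann_curvature gm x v w z = (dd v (\<lambda>x. \<Gamma> x w z) x + \<Gamma> x v (\<Gamma> x w z))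
      - (dd w (\<lambda>x. \<Gamma> x v z) x + \<Gamma> x w (\<Gamma> x v z))"
    unfolding riemann_curvature_def cov_deriv_gm by simp
  also have "\<dots> = C w z *\<^sub>R v - C v z *\<^sub>R w + T x w z *\<^sub>R dd v q x - T x v z *\<^sub>R dd w q x"
    unfolding dd\<Gamma> \<Gamma>_def[of x v "\<Gamma> x w z"] \<Gamma>_def[of x w "\<Gamma> x v z"] u\<Gamma> T\<Gamma> cod com C_def
    by (simp add: \<Gamma>_def T_symmetric[of x w v] double algebra_simps)
  also have "\<dots> = (gm x w z) *\<^sub>R v - (gm x v z) *\<^sub>R w
     - (T x w z / V x) *\<^sub>R W x v + (T x v z / V x) *\<^sub>R W x w"
    unfolding C W_def by (simp add: algebra_simps)
  finally show ?thesis .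
qed

lemma linear_gm: "linear (\<lambda>v. gm x v z)"
  by (rule linearI) (simp_all add: gm_eq inner_add_left algebra_simps add_divide_distrib diff_divide_distrib)

text \<open>The contracted Gauss equation, written as \<open>gm\<close> of an operator so that
  raising an index just reads off that operator.\<close>

lemma ricci_gm:
  "ricci gm x w z = gm x ((real DIM('a) - 1) *\<^sub>R w - lin_trace (W x) *\<^sub>R W x w + W x (W x w)) z"
proof -
  have "(\<Sum>b\<in>Basis. gm x b z * (w \<bullet> b)) = gm x w z"
    using lin_trace_linear_inner[of "\<lambda>v. gm x v z" w 1] linear_gm by (simp add: mult.commute)
  moreover have "(\<Sum>b\<in>Basis. T x b z * (W x w \<bullet> b)) = T x (W x w) z"
    using lin_trace_linear_inner[of "\<lambda>v. T x v z" "W x w" 1] linear_T[of x z]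
    by (simp add: mult.commute T_symmetric[of x _ z])
  ultimately have "ricci gm x w z = real DIM('a) * gm x w z - gm x w z - T x w z / V x * lin_trace (W x)
      + T x (W x w) z / V x"
    by (simp add: ricci_def lin_trace_def riemann_curvature_gm inner_add_left inner_diff_left sum.distrib
        sum_subtractf sum_distrib_left[symmetric] sum_divide_distrib[symmetric] inner_Basis)
  then show ?thesis
    by (simp add: linear_add[OF linear_gm] linear_diff[OF linear_gm] linear_scale[OF linear_gm] gm_W algebra_simps)
qed

lemma scalar_curvature_gm:
  "scalar_curvature gm x = real DIM('a) * (real DIM('a) - 1) - (lin_trace (W x))\<^sup>2 + lin_trace (\<lambda>v. W x (W x v))"
proof -
  have "sharp gm x (ricci gm x v) = (real DIM('a) - 1) *\<^sub>R v - lin_trace (W x) *\<^sub>R W x v + W x (W x v)" for v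
    by (rule sharp_gm) (simp add: ricci_gm)
  then show ?thesis
    by (simp add: scalar_curvature_def)
      (simp add: lin_trace_def inner_add_left inner_diff_left sum.distrib sum_subtractf
        sum_distrib_left[symmetric] power2_eq_square)
qed

end

section \<open>A maximum principle\<close>

lemma coercive_attains_max:
  fixes \<Phi> :: "'a::euclidean_space \<Rightarrow> real"
  assumes "continuous_on UNIV \<Phi>" "\<And>x. \<Phi> x \<le> B - \<epsilon> * norm x" "\<epsilon> > 0"
  obtains x where "\<And>y. \<Phi> y \<le> \<Phi> x"
proof -
  \<comment> \<open>Outside the ball of radius \<open>R\<close> the coercive bound is already below
    \<open>\<Phi> 0\<close>.\<close>
  define R where "R = (B - \<Phi> 0) / \<epsilon>"
  have "R \<ge> 0" using assms(2)[of 0] \<open>\<epsilon> > 0\<close> by (simp add: R_def)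
  then obtain x where x: "\<forall>y\<in>cball 0 R. \<Phi> y \<le> \<Phi> x"
    using continuous_attains_sup[OF compact_cball _ continuous_on_subset[OF assms(1)], of 0 R] by fastforce
  have "\<Phi> y \<le> \<Phi> x" for y
  proof (cases "norm y \<le> R")
    case False
    then have "\<epsilon> * R \<le> \<epsilon> * norm y" using \<open>\<epsilon> > 0\<close> by simp
    then have "\<Phi> y \<le> \<Phi> 0" using assms(2)[of y] \<open>\<epsilon> > 0\<close> by (simp add: R_def)
    also have "\<dots> \<le> \<Phi> x" using x \<open>R \<ge> 0\<close> by simp
    finally show ?thesis .
  qed (use x in auto)
  then show thesis by (rule that)
qed

text \<open>A positive second derivative would make \<open>dd w F\<close> positive just after
  \<open>x\<close>, and the mean value theorem would then push \<open>F\<close> above its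
  maximum.\<close>

lemma dd_at_max:
  fixes F :: "'a::euclidean_space \<Rightarrow> real"
  assumes F: "smooth F" and max: "\<And>y. F y \<le> F x"
  shows "dd w F x = 0" "dd w (dd w F) x \<le> 0"
proof -
  note D = smooth_along_line[OF F, of x w]
  show D0: "dd w F x = 0"
    using DERIV_local_max[OF D[of 0 UNIV] zero_less_one] max by simp
  show "dd w (dd w F) x \<le> 0"
  proof (rule ccontr)
    assume "\<not> ?thesis"
    then obtain d where d: "d > 0" "\<And>h. h > 0 \<Longrightarrow> h < d \<Longrightarrow> dd w F x < dd w F (x + h *\<^sub>R w)"
      using DERIV_pos_inc_right[OF smooth_along_line[OF smooth_dd[OF F], of w x w 0]] by auto
    have "\<exists>z>0. z < d \<and> F (x + d *\<^sub>R w) - F (x + 0 *\<^sub>R w) = (d - 0) * dd w F (x + z *\<^sub>R w)"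
      by (rule MVT2[OF d(1)]) (rule D)
    then obtain z where "z > 0" "z < d" "F (x + d *\<^sub>R w) - F x = d * dd w F (x + z *\<^sub>R w)" by auto
    with d D0 max[of "x + d *\<^sub>R w"] show False
      by (metis diff_gt_0_iff_gt mult_pos_pos not_less)
  qed
qed

section \<open>The comparison function and its derivative bounds\<close>

lemma smooth_sqrt_one_plus [simp]: "smooth (\<lambda>x::'a::euclidean_space. sqrt (1 + x \<bullet> x))"
  by (intro smooth_sqrt) (simp_all add: add_pos_nonneg)

lemma norm_le_sqrt_one_plus: "norm x \<le> sqrt (1 + x \<bullet> x)"
  by (simp add: norm_eq_sqrt_inner)

text \<open>Comes from differentiating the square; the product form can be differentiated again
  without quotients.\<close>

lemma sqrt_one_plus_dd:
  fixes x :: "'a::euclidean_space"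
  shows "sqrt (1 + x \<bullet> x) * dd w (\<lambda>x. sqrt (1 + x \<bullet> x)) x = w \<bullet> x"
proof -
  let ?\<gamma> = "\<lambda>x::'a. sqrt (1 + x \<bullet> x)"
  have "(\<lambda>x. ?\<gamma> x * ?\<gamma> x) = (\<lambda>x. 1 + x \<bullet> x)"
    by (simp only: real_sqrt_mult_self abs_of_nonneg[OF add_nonneg_nonneg[OF zero_le_one inner_ge_zero]])
  moreover have "dd w (\<lambda>x. ?\<gamma> x * ?\<gamma> x) x = 2 * (?\<gamma> x * dd w ?\<gamma> x)"
    by (subst dd_mult) simp_all
  moreover have "dd w (\<lambda>x. 1 + x \<bullet> x) x = 2 * (w \<bullet> x)"
    by (simp add: inner_commute)
  ultimately show ?thesis by simp
qed

lemma abs_dd_sqrt_one_plus_le: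
  fixes x :: "'a::euclidean_space"
  shows "\<bar>dd w (\<lambda>x. sqrt (1 + x \<bullet> x)) x\<bar> \<le> norm w"
proof -
  let ?r = "sqrt (1 + x \<bullet> x)"
  have r: "?r > 0" by (simp add: add_pos_nonneg)
  have "?r * \<bar>dd w (\<lambda>x. sqrt (1 + x \<bullet> x)) x\<bar> = \<bar>w \<bullet> x\<bar>"
    using arg_cong[OF sqrt_one_plus_dd[of x w], of abs] unfolding abs_mult abs_of_pos[OF r] .
  also have "\<dots> \<le> norm w * norm x" by (rule Cauchy_Schwarz_ineq2)
  also have "\<dots> \<le> ?r * norm w"
    using mult_left_mono[OF norm_le_sqrt_one_plus norm_ge_zero] by (simp only: mult.commute)
  finally show ?thesis using r by simp
qed

text \<open>Differentiating \<open>sqrt_one_plus_dd\<close> leaves a square with favourable sign,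
  and the root is at least \<open>1\<close>.\<close>

lemma dd_dd_sqrt_one_plus_le:
  fixes x :: "'a::euclidean_space"
  shows "dd w (dd w (\<lambda>x. sqrt (1 + x \<bullet> x))) x \<le> w \<bullet> w"
proof -
  let ?\<gamma> = "\<lambda>x::'a. sqrt (1 + x \<bullet> x)"
  have "dd w (\<lambda>x. ?\<gamma> x * dd w ?\<gamma> x) x = dd w (\<lambda>x. w \<bullet> x) x"
    by (simp only: sqrt_one_plus_dd)
  then have "?\<gamma> x * dd w (dd w ?\<gamma>) x + dd w ?\<gamma> x * dd w ?\<gamma> x = w \<bullet> w" by simp
  then have le: "?\<gamma> x * dd w (dd w ?\<gamma>) x \<le> w \<bullet> w"
    using zero_le_square[of "dd w ?\<gamma> x"] by linarith
  have "1 \<le> ?\<gamma> x" by simp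
  then have "w \<bullet> w \<le> ?\<gamma> x * (w \<bullet> w)"
    using mult_right_mono[of 1 "?\<gamma> x" "w \<bullet> w"] by simp
  with le have "?\<gamma> x * dd w (dd w ?\<gamma>) x \<le> ?\<gamma> x * (w \<bullet> w)" by linarith
  moreover have "?\<gamma> x > 0" using \<open>1 \<le> ?\<gamma> x\<close> by linarith
  ultimately show ?thesis by (rule mult_left_le_imp_le)
qed

section \<open>The Laplacian of \<open>exp h (cosh \<theta> - 1)\<close>\<close>

context spacelike_graph
begin

section \<open>The divergence of \<open>q\<close> and the Hessian of \<open>c\<close>\<close>

definition "div_q x = (\<Sum>b\<in>Basis. dd b q x \<bullet> b)"

lemma smooth_div_q [simp]: "smooth div_q"
  unfolding div_q_def[abs_def] by simp

lemma trace_W: "lin_trace (W x) = real DIM('a) * c x - V x * div_q x"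
  by (simp add: lin_trace_def W_def inner_diff_left sum_subtractf div_q_def sum_distrib_left)

lemma trace_W_square:
  "lin_trace (\<lambda>v. W x (W x v)) = real DIM('a) * (c x * c x) - 2 * c x * (V x * div_q x)
     + V x * V x * lin_trace (\<lambda>v. dd (dd v q x) q x)"
proof -
  have dW: "dd (W x v) q x = c x *\<^sub>R dd v q x - V x *\<^sub>R dd (dd v q x) q x" for v
    unfolding W_def by (simp add: linear_diff[OF linear_dd_q] linear_scale[OF linear_dd_q])
  have WW: "W x (W x v) = c x *\<^sub>R W x v - V x *\<^sub>R (c x *\<^sub>R dd v q x - V x *\<^sub>R dd (dd v q x) q x)" for v
    by (simp only: W_def[of x "W x v"] dW)
  have "W x (W x v) \<bullet> b = c x * c x * (v \<bullet> b) - 2 * c x * (V x * (dd v q x \<bullet> b))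
      + V x * V x * (dd (dd v q x) q x \<bullet> b)" for v b
    unfolding WW by (simp add: W_def inner_diff_left algebra_simps)
  then show ?thesis
    by (simp add: lin_trace_def div_q_def sum.distrib sum_subtractf sum_distrib_left[symmetric])
qed

text \<open>Gives the trace of the Hessian of \<open>V\<close> against \<open>I + q q^T\<close>,
  which arises when \<open>V f = c - 1\<close> is differentiated twice.\<close>

lemma div_q_eq: "div_q x = c x * ((\<Sum>b\<in>Basis. dd b p x \<bullet> b) + dd (q x) p x \<bullet> q x)"
proof -
  have "(\<Sum>b\<in>Basis. (q x \<bullet> dd b p x) * (q x \<bullet> b)) = dd (q x) p x \<bullet> q x"
    using lin_trace_linear_inner[OF linear_dd_p[of x], of "q x" "q x"]
    by (simp add: inner_commute[of _ "q x"] mult.commute)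
  then show ?thesis
    by (simp add: div_q_def dd_q inner_add_left sum.distrib sum_distrib_left[symmetric])
qed

text \<open>The \<open>g\<close>-self-adjointness of the shape operator, applied to \<open>q\<close>; its divergence gives \<open>trace_hessian_c\<close>.\<close>

lemma dd_c_adjoint: "dd b c x + dd (q x) c x * (q x \<bullet> b) = c x * (dd (q x) q x \<bullet> b)"
proof -
  have 1: "dd (q x) p x \<bullet> v = c x * (p x \<bullet> dd v p x)" for v
    using dd_p_symmetric[of "q x" x v] by (simp add: q_def inner_commute)
  have "dd (q x) c x = c x * c x * (q x \<bullet> dd (q x) p x)"
    by (simp add: dd_c q_def)
  then show ?thesis
    unfolding dd_q by (simp add: dd_c inner_add_left 1 algebra_simps)
qed

lemma dd_dir_sum:
  fixes F :: "'a \<Rightarrow> real"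
  shows "smooth F \<Longrightarrow> dd (q x) F x = (\<Sum>j\<in>Basis. (q x \<bullet> j) * dd j F x)"
  by (subst dd_eq_sum_Basis) simp_all

lemma dd_q_dir_sum: "dd (q x) q x \<bullet> b = (\<Sum>j\<in>Basis. (q x \<bullet> j) * (dd j q x \<bullet> b))"
  by (subst dd_eq_sum_Basis) (simp_all add: inner_sum_left)

text \<open>The direction \<open>w\<close> is frozen: with \<open>q x\<close> for \<open>w\<close>
  this is the Hessian term alone, without derivatives of \<open>q\<close>.\<close>

lemma dd_dd_dir_sum:
  fixes F :: "'a \<Rightarrow> real"
  assumes F: "smooth F"
  shows "dd w (dd w F) x = (\<Sum>b\<in>Basis. (w \<bullet> b) * (\<Sum>j\<in>Basis. (w \<bullet> j) * dd b (dd j F) x))"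
proof -
  have "dd w (dd w F) x = (\<Sum>b\<in>Basis. (w \<bullet> b) * dd w (dd b F) x)"
    using F by (subst dd_eq_sum_Basis) (simp_all add: dd_commute[of F _ w])
  moreover have "dd w (dd b F) x = (\<Sum>j\<in>Basis. (w \<bullet> j) * dd b (dd j F) x)" for b
    using F by (subst dd_eq_sum_Basis) (simp_all add: dd_commute[of F _ b])
  ultimately show ?thesis by simp
qed

lemma trace_hessian_c:
  "(\<Sum>b\<in>Basis. dd b (dd b c) x) + dd (q x) (dd (q x) c) x + dd (q x) c x * div_q x
     = c x * (lin_trace (\<lambda>v. dd (dd v q x) q x) + dd (q x) div_q x)"
proof -
  \<comment> \<open>The direction \<open>q x\<close> moves with the point, so it is expanded over
    the basis before the divergence is taken.\<close>
  let ?L = "\<lambda>b x. dd b c x + (\<Sum>j\<in>Basis. (q x \<bullet> j) * dd j c x) * (q x \<bullet> b)"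
  let ?R = "\<lambda>b x. c x * (\<Sum>j\<in>Basis. (q x \<bullet> j) * (dd j q x \<bullet> b))"
  have eq: "?L b = ?R b" for b
    using dd_c_adjoint[of b] unfolding dd_dir_sum[OF smooth_c] dd_q_dir_sum by blast
  have L: "dd b (?L b) x = dd b (dd b c) x + dd (q x) c x * (dd b q x \<bullet> b)
      + (q x \<bullet> b) * (\<Sum>j\<in>Basis. (dd b q x \<bullet> j) * dd j c x)
      + (q x \<bullet> b) * (\<Sum>j\<in>Basis. (q x \<bullet> j) * dd b (dd j c) x)" for b
    by (simp add: dd_dir_sum sum.distrib algebra_simps)
  have R: "dd b (?R b) x = dd b c x * (dd (q x) q x \<bullet> b)
      + c x * ((\<Sum>j\<in>Basis. (dd b q x \<bullet> j) * (dd j q x \<bullet> b))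
             + (\<Sum>j\<in>Basis. (q x \<bullet> j) * (dd j (dd b q) x \<bullet> b)))" for b
    by (simp add: dd_q_dir_sum dd_commute[of q b] sum.distrib algebra_simps)
  have 1: "(\<Sum>b\<in>Basis. (q x \<bullet> b) * (\<Sum>j\<in>Basis. (dd b q x \<bullet> j) * dd j c x))
      = (\<Sum>j\<in>Basis. dd j c x * (dd (q x) q x \<bullet> j))"
    unfolding dd_q_dir_sum sum_distrib_left by (subst sum.swap) (simp add: mult_ac)
  have 2: "(\<Sum>j\<in>Basis. (dd b q x \<bullet> j) * (dd j q x \<bullet> b)) = dd (dd b q x) q x \<bullet> b" for b
    by (rule lin_trace_linear_inner[OF linear_dd_q])
  have 3: "(\<Sum>b\<in>Basis. \<Sum>j\<in>Basis. (q x \<bullet> j) * (dd j (dd b q) x \<bullet> b)) = dd (q x) div_q x"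
    unfolding dd_dir_sum[OF smooth_div_q] unfolding div_q_def[abs_def]
    by (subst sum.swap) (simp add: sum_distrib_left)
  have "(\<Sum>b\<in>Basis. dd b (?L b) x) = (\<Sum>b\<in>Basis. dd b (?R b) x)"
    by (simp only: eq)
  then show ?thesis
    unfolding L R
    by (simp add: sum.distrib 1 2 3 dd_dd_dir_sum[OF smooth_c, of "q x"] div_q_def lin_trace_def
        sum_distrib_left[symmetric] distrib_left)
qed

text \<open>The Laplacian of the induced metric when the mean curvature is \<open>H\<close>.\<close>

definition Lap :: "real \<Rightarrow> ('a \<Rightarrow> real) \<Rightarrow> 'a \<Rightarrow> real" where
  "Lap H F x = V x * V x * ((\<Sum>b\<in>Basis. dd b (dd b F) x) + dd (q x) (dd (q x) F) x)
     + V x * (2 * c x - real DIM('a) * H) * dd (q x) F x"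

definition "f x = (c x - 1) * exp (u x)"

lemma smooth_f [simp]: "smooth f"
  unfolding f_def[abs_def] by simp

lemma V_f: "V x * f x = c x - 1"
  by (simp add: f_def exp_u)

lemma dd_f: "(w \<bullet> p x) * f x + V x * dd w f x = dd w c x"
proof -
  have "dd w (\<lambda>x. V x * f x) x = dd w (\<lambda>x. c x - 1) x" unfolding V_f ..
  then show ?thesis by simp
qed

lemma dd_dd_f: "(dd w p x \<bullet> w) * f x + 2 * (w \<bullet> p x) * dd w f x + V x * dd w (dd w f) x = dd w (dd w c) x"
proof -
  have "dd w (\<lambda>x. (w \<bullet> p x) * f x + V x * dd w f x) x = dd w (dd w c) x" unfolding dd_f ..
  then show ?thesis by (simp add: inner_commute algebra_simps)
qed

text \<open>\<open>dd_dd_f\<close> is contracted with \<open>I + q q^T\<close>, which maps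
  \<open>p\<close> to \<open>c q\<close>; this produces the cross term \<open>2 c\<close>, which the
  first-order part of \<open>Lap\<close> cancels.\<close>

lemma trace_hessian_f:
  "V x * ((\<Sum>b\<in>Basis. dd b (dd b f) x) + dd (q x) (dd (q x) f) x)
    = (\<Sum>b\<in>Basis. dd b (dd b c) x) + dd (q x) (dd (q x) c) x - f x * (div_q x / c x) - 2 * c x * dd (q x) f x"
proof -
  have "(\<Sum>b\<in>Basis. (b \<bullet> p x) * dd b f x) = dd (p x) f x"
    by (subst (2) dd_eq_sum_Basis) (simp_all add: inner_commute)
  moreover have "dd (q x) f x = c x * dd (p x) f x"
    by (simp add: q_def dd_scaleR_dir)
  moreover have "c x * (q x \<bullet> p x) = c x * c x - 1"
    by (simp add: q_def p_inner_p algebra_simps)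
  ultimately have 1: "(\<Sum>b\<in>Basis. (b \<bullet> p x) * dd b f x) + (q x \<bullet> p x) * dd (q x) f x = c x * dd (q x) f x"
    by (simp add: mult.assoc[symmetric] mult.commute[of "q x \<bullet> p x"] left_diff_distrib)
  have 2: "div_q x / c x = (\<Sum>b\<in>Basis. dd b p x \<bullet> b) + dd (q x) p x \<bullet> q x"
    by (simp add: div_q_eq)
  show ?thesis
    unfolding 2 dd_dd_f[symmetric] using 1
    by (simp add: sum.distrib sum_distrib_left[symmetric] sum_distrib_right[symmetric] mult.assoc distrib_left)
qed

text \<open>Constant mean curvature makes \<open>V div_q\<close> equal to \<open>n (c - H)\<close>
  everywhere, so it may also be differentiated along \<open>q\<close>; this removes the third
  derivatives of \<open>V\<close>.\<close>

lemma Lap_f: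
  assumes H: "\<And>x. lin_trace (W x) = real DIM('a) * H"
  shows "V x * Lap H f x = c x * lin_trace (\<lambda>v. W x (W x v)) - real DIM('a) * (c x * H + H - 1)"
proof -
  let ?n = "real DIM('a)"
  have cmc: "V x * div_q x = ?n * (c x - H)" for x
    using H[of x] trace_W[of x] by (simp add: algebra_simps)
  have "dd (q x) (\<lambda>x. V x * div_q x) x = dd (q x) (\<lambda>x. ?n * (c x - H)) x" unfolding cmc ..
  then have dcmc: "(q x \<bullet> p x) * div_q x + V x * dd (q x) div_q x = ?n * dd (q x) c x" by simp
  have qp: "q x \<bullet> p x = c x - 1 / c x"
    by (simp add: q_def p_inner_p algebra_simps)
  define D where "D = dd (q x) c x"
  define t where "t = lin_trace (\<lambda>v. dd (dd v q x) q x)"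
  have hess: "(\<Sum>b\<in>Basis. dd b (dd b c) x) + dd (q x) (dd (q x) c) x = c x * (t + dd (q x) div_q x) - D * div_q x"
    using trace_hessian_c[of x] by (simp add: D_def t_def)
  have "Lap H f x = V x * (V x * ((\<Sum>b\<in>Basis. dd b (dd b f) x) + dd (q x) (dd (q x) f) x))
     + V x * (2 * c x - ?n * H) * dd (q x) f x" by (simp add: Lap_def mult.assoc)
  also have "\<dots> = V x * (c x * (t + dd (q x) div_q x) - D * div_q x - f x * (div_q x / c x))
      - ?n * H * (V x * dd (q x) f x)"
    unfolding trace_hessian_f hess by (simp add: algebra_simps)
  also have "V x * dd (q x) f x = D - (q x \<bullet> p x) * f x"
    using dd_f[of "q x" x] by (simp add: D_def)
  also have "V x * (c x * (t + dd (q x) div_q x) - D * div_q x - f x * (div_q x / c x))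
     = c x * (V x * t + V x * dd (q x) div_q x) - (D + f x / c x) * (V x * div_q x)"
    by (simp add: algebra_simps)
  also have "V x * dd (q x) div_q x = ?n * D - (q x \<bullet> p x) * div_q x" using dcmc by (simp add: D_def)
  finally have L: "Lap H f x = c x * (V x * t + (?n * D - (q x \<bullet> p x) * div_q x)) - (D + f x / c x) * (V x * div_q x)
      - ?n * H * (D - (q x \<bullet> p x) * f x)" .
  have "V x * Lap H f x = c x * (V x * V x * t + ?n * V x * D - (q x \<bullet> p x) * (V x * div_q x))
      - (V x * D + V x * f x / c x) * (V x * div_q x) - ?n * H * (V x * D - (q x \<bullet> p x) * (V x * f x))"
    unfolding L by (simp add: algebra_simps)
  \<comment> \<open>The terms in \<open>D\<close> cancel: their coefficients are \<open>n c\<close>,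
    \<open>- n (c - H)\<close> and \<open>- n H\<close>.\<close>
  also have "\<dots> = c x * (V x * V x * t - (c x - 1 / c x) * (?n * (c x - H)))
      - ((c x - 1) / c x) * (?n * (c x - H)) + ?n * H * ((c x - 1 / c x) * (c x - 1))"
    unfolding cmc V_f qp by (simp add: algebra_simps)
  also have "\<dots> = c x * (?n * (c x * c x) - 2 * c x * (?n * (c x - H)) + V x * V x * t) - ?n * (c x * H + H - 1)"
    by (simp add: field_simps)
  finally show ?thesis unfolding trace_W_square cmc t_def .
qed

text \<open>Along the graph, the gradient and Laplacian of \<open>sqrt (1 + |x|\<^sup>2)\<close> stay bounded because
  \<open>V\<close> and \<open>c\<close> are; this replaces the Omori-Yau maximum principle.\<close>

lemma exists_Lap_less:
  assumes F: "smooth F" and bdd: "\<And>x. F x \<le> B" and "\<And>x. V x \<le> 1" "\<And>x. c x \<le> 2" "\<delta> > 0"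
  shows "\<exists>x. Lap H F x < \<delta>"
proof -
  define \<gamma> where "\<gamma> x = sqrt (1 + x \<bullet> x)" for x :: 'a
  \<comment> \<open>The Hessian part is bounded by \<open>n + |q|^2 \<le> n + 3\<close>, since
    \<open>|q|^2 = c^2 - 1\<close>; the first-order part by the coefficient \<open>4 + n |H|\<close>
    times \<open>|q| \<le> 2\<close>.\<close>
  define C where "C = real DIM('a) + 3 + (4 + real DIM('a) * \<bar>H\<bar>) * 2"
  define \<epsilon> where "\<epsilon> = \<delta> / (2 * C)"
  have C: "C > 0" by (simp add: C_def add_nonneg_pos add_pos_nonneg)
  then have \<epsilon>: "\<epsilon> > 0" "\<epsilon> * C < \<delta>" using \<open>\<delta> > 0\<close> by (simp_all add: \<epsilon>_def)
  have sm\<gamma> [simp]: "smooth \<gamma>"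
    unfolding \<gamma>_def[abs_def] by (intro smooth_sqrt) (simp_all add: add_pos_nonneg)
  define \<Phi> where "\<Phi> x = F x - \<epsilon> * \<gamma> x" for x
  have sm\<Phi>: "smooth \<Phi>" unfolding \<Phi>_def[abs_def] using F by simp
  have "\<Phi> y \<le> B - \<epsilon> * norm y" for y
    using bdd[of y] mult_left_mono[OF norm_le_sqrt_one_plus[of y] less_imp_le[OF \<epsilon>(1)]]
    unfolding \<Phi>_def \<gamma>_def by linarith
  then obtain x where x: "\<And>y. \<Phi> y \<le> \<Phi> x"
    using coercive_attains_max[OF smooth_continuous_on[OF sm\<Phi>] _ \<epsilon>(1), of B] by blast
  have D\<Phi>: "dd w \<Phi> x = 0" and DD\<Phi>: "dd w (dd w \<Phi>) x \<le> 0" for w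
    using dd_at_max[OF sm\<Phi> x] by auto
  have DF: "dd w F x = \<epsilon> * dd w \<gamma> x" for w
    using D\<Phi>[of w] F unfolding \<Phi>_def[abs_def] by simp
  have DDF: "dd w (dd w F) x \<le> \<epsilon> * (w \<bullet> w)" for w
  proof -
    have "dd w (dd w F) x \<le> \<epsilon> * dd w (dd w \<gamma>) x"
      using DD\<Phi>[of w] F unfolding \<Phi>_def[abs_def] by simp
    also have "\<dots> \<le> \<epsilon> * (w \<bullet> w)"
      using \<epsilon>(1) dd_dd_sqrt_one_plus_le[of w x] by (simp add: \<gamma>_def[abs_def] mult_left_mono)
    finally show ?thesis .
  qed
  have cc: "c x * c x \<le> 2 * 2" using assms(4)[of x] c_ge_1[of x] by (intro mult_mono) auto
  then have qq: "q x \<bullet> q x \<le> 3" by (simp add: q_inner_q)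
  then have "(norm (q x))\<^sup>2 \<le> 2\<^sup>2" by (simp add: power2_norm_eq_inner)
  then have nq: "norm (q x) \<le> 2" by (rule power2_le_imp_le) simp
  have VV: "V x * V x \<le> 1" using assms(3)[of x] V_pos[of x] by (intro mult_le_one) (auto simp: less_imp_le)
  have "(\<Sum>b\<in>Basis. dd b (dd b F) x) \<le> (\<Sum>b\<in>(Basis::'a set). \<epsilon> * (b \<bullet> b))"
    by (rule sum_mono) (rule DDF)
  also have "\<dots> = \<epsilon> * real DIM('a)" by simp
  finally have "(\<Sum>b\<in>Basis. dd b (dd b F) x) + dd (q x) (dd (q x) F) x \<le> \<epsilon> * (real DIM('a) + 3)"
    using DDF[of "q x"] mult_left_mono[OF qq less_imp_le[OF \<epsilon>(1)]] by (simp only: distrib_left)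
  then have "V x * V x * ((\<Sum>b\<in>Basis. dd b (dd b F) x) + dd (q x) (dd (q x) F) x)
      \<le> V x * V x * (\<epsilon> * (real DIM('a) + 3))"
    by (rule mult_left_mono) simp
  also have "\<dots> \<le> 1 * (\<epsilon> * (real DIM('a) + 3))"
    by (rule mult_right_mono[OF VV]) (use \<epsilon>(1) in simp)
  finally have 1: "V x * V x * ((\<Sum>b\<in>Basis. dd b (dd b F) x) + dd (q x) (dd (q x) F) x)
      \<le> 1 * (\<epsilon> * (real DIM('a) + 3))" .
  have 2: "\<bar>V x * (2 * c x - real DIM('a) * H) * dd (q x) F x\<bar>
      \<le> 1 * (4 + real DIM('a) * \<bar>H\<bar>) * (\<epsilon> * 2)"
    unfolding abs_mult
  proof (intro mult_mono)
    show "\<bar>V x\<bar> \<le> 1" using assms(3)[of x] V_pos[of x] by (simp add: abs_of_pos)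
    have "\<bar>2 * c x - real DIM('a) * H\<bar> \<le> \<bar>2 * c x\<bar> + \<bar>real DIM('a) * H\<bar>" by (rule abs_triangle_ineq4)
    also have "\<dots> \<le> 4 + real DIM('a) * \<bar>H\<bar>" using assms(4)[of x] c_ge_1[of x] by (simp add: abs_mult)
    finally show "\<bar>2 * c x - real DIM('a) * H\<bar> \<le> 4 + real DIM('a) * \<bar>H\<bar>" .
    have "\<bar>dd (q x) \<gamma> x\<bar> \<le> 2"
      using abs_dd_sqrt_one_plus_le[of "q x" x] nq by (simp add: \<gamma>_def[abs_def])
    then show "\<bar>dd (q x) F x\<bar> \<le> \<epsilon> * 2"
      using \<epsilon>(1) by (simp add: DF abs_mult)
  qed auto
  have "Lap H F x \<le> \<epsilon> * C"
  proof -
    have "\<epsilon> * C = 1 * (\<epsilon> * (real DIM('a) + 3)) + 1 * (4 + real DIM('a) * \<bar>H\<bar>) * (\<epsilon> * 2)"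
      by (simp add: C_def distrib_left distrib_right)
    then show ?thesis unfolding Lap_def by (simp only: add_mono[OF 1 abs_le_D1[OF 2]])
  qed
  then show ?thesis using \<epsilon>(2) by (intro exI[of _ x]) linarith
qed

section \<open>Rigidity for constant mean curvature\<close>

lemma trace_W_square_ge_H:
  assumes "lin_trace (W x) = real DIM('a) * H"
  shows "lin_trace (\<lambda>v. W x (W x v)) \<ge> real DIM('a) * H\<^sup>2"
proof -
  have "real DIM('a) * (real DIM('a) * H\<^sup>2) = (lin_trace (W x))\<^sup>2"
    unfolding assms by (simp add: power2_eq_square)
  also have "\<dots> \<le> real DIM('a) * lin_trace (\<lambda>v. W x (W x v))"
    by (rule trace_W_square_ge)
  finally show ?thesis by simp
qed

text \<open>The hypothesis on \<open>c - 1\<close> is \<open>f \<le> 1\<close>, and with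
  \<open>V \<le> 1\<close> it also gives \<open>c \<le> 2\<close>. As \<open>0 < V \<le> 1\<close>,
  multiplying by \<open>V\<close> cannot raise \<open>Lap\<close> above its positive part.\<close>

lemma not_V_Lap_f_ge:
  assumes "\<And>x. V x \<le> 1" "\<And>x. c x - 1 \<le> V x" "\<delta> > 0"
  shows "\<exists>x. V x * Lap H f x < \<delta>"
proof -
  have "f x \<le> 1" for x
    using assms(2)[of x] by (simp add: f_def exp_u)
  moreover have "c x \<le> 2" for x using assms(1,2)[of x] by linarith
  ultimately obtain x where "Lap H f x < \<delta>"
    using exists_Lap_less[OF smooth_f _ assms(1) _ assms(3), of 1] by blast
  moreover have "V x * Lap H f x \<le> max 0 (Lap H f x)"
  proof (cases "Lap H f x \<ge> 0")
    case True
    then show ?thesis using mult_right_mono[OF assms(1) True] by simp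
  next
    case False
    then show ?thesis using mult_pos_neg[OF V_pos, of "Lap H f x" x] by simp
  qed
  ultimately show ?thesis using assms(3) by (intro exI[of _ x]) simp
qed

lemma cmc_rigidity:
  assumes V: "\<And>x. V x \<le> 1" and c: "\<And>x. c x - 1 \<le> V x"
    and H: "\<And>x. lin_trace (W x) = real DIM('a) * H" "H \<ge> 1"
  shows "H = 1" "scalar_curvature gm x \<ge> 0" "\<alpha> > 0 \<Longrightarrow> \<exists>x. scalar_curvature gm x < \<alpha>"
proof -
  let ?n = "real DIM('a)"
  note Wge = trace_W_square_ge_H[OF H(1)]
  show H1: "H = 1"
  proof (rule ccontr)
    assume "H \<noteq> 1"
    then have d: "?n * (H - 1)\<^sup>2 > 0" by simp
    have le: "?n * (H - 1)\<^sup>2 \<le> V x * Lap H f x" for x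
    proof -
      have "?n * (H - 1) * (1 * H - 1) \<le> ?n * (H - 1) * (c x * H - 1)"
        using H(2) c_ge_1[of x] by (intro mult_left_mono diff_right_mono mult_right_mono) auto
      moreover have "c x * (?n * H\<^sup>2) \<le> c x * lin_trace (\<lambda>v. W x (W x v))"
        using Wge by (intro mult_left_mono) (auto simp: less_imp_le)
      moreover have "c x * (?n * H\<^sup>2) - ?n * (c x * H + H - 1) = ?n * (H - 1) * (c x * H - 1)"
        by (simp add: power2_eq_square algebra_simps)
      ultimately show ?thesis unfolding Lap_f[OF H(1)] power2_eq_square[of "H - 1"]
        by (simp only: mult_1 mult.assoc[of ?n "H - 1"])
    qed
    obtain x where "V x * Lap H f x < ?n * (H - 1)\<^sup>2"
      using not_V_Lap_f_ge[OF V c d] by blast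
    with le[of x] show False by linarith
  qed
  have R: "scalar_curvature gm x = lin_trace (\<lambda>v. W x (W x v)) - ?n" for x
    unfolding scalar_curvature_gm H(1) H1 by (simp add: power2_eq_square algebra_simps)
  show nonneg: "scalar_curvature gm x \<ge> 0" for x
    using Wge[of x] by (simp add: R H1)
  assume "\<alpha> > 0"
  then obtain x where x: "V x * Lap H f x < \<alpha>" using not_V_Lap_f_ge[OF V c, of \<alpha> H] by blast
  \<comment> \<open>Nonnegativity of the curvature and \<open>c \<ge> 1\<close> let
    \<open>c R\<close> dominate \<open>R\<close>.\<close>
  have "1 * scalar_curvature gm x \<le> c x * scalar_curvature gm x"
    by (intro mult_right_mono c_ge_1 nonneg)
  also have "\<dots> = V x * Lap H f x"
    unfolding Lap_f[OF H(1)] R by (simp add: H1 algebra_simps)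
  finally show "\<exists>x. scalar_curvature gm x < \<alpha>" using x by (intro exI[of _ x]) linarith
qed

end

section \<open>Vertical graphs in the Steady State space\<close>

lemma steady_state_metric_ext:
  assumes "\<And>z. steady_state_metric r X z = steady_state_metric r Y z"
  shows "X = (Y :: real \<times> (real^'n))"
proof (rule prod_eqI)
  show "fst X = fst Y"
    using assms[of "(1, 0)"] by (simp add: steady_state_metric_def)
  have "\<forall>w. snd X \<bullet> w = snd Y \<bullet> w"
    using assms[of "(0, w)" for w] by (simp add: steady_state_metric_def)
  then show "snd X = snd Y" by (simp add: vector_eq_rdot)
qed

lemma sharp_steady_state:
  assumes "\<And>z. steady_state_metric r X z = \<phi> z"
  shows "sharp steady_state_metric r \<phi> = (X :: real \<times> (real^'n))"
  unfolding sharp_def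
proof (rule the_equality)
  fix Y assume "\<forall>z. steady_state_metric r Y z = \<phi> z"
  then show "Y = X" by (intro steady_state_metric_ext[of r]) (metis assms)
qed (use assms in blast)

lemma christoffel_steady_state:
  fixes v w :: "real \<times> (real^'n)"
  shows "christoffel steady_state_metric r v w =
    (exp (2 * fst r) * (snd v \<bullet> snd w), fst v *\<^sub>R snd w + fst w *\<^sub>R snd v)"
proof -
  have "dd y (\<lambda>r. steady_state_metric r a b) = (\<lambda>r. 2 * fst y * exp (2 * fst r) * (snd a \<bullet> snd b))"
    for y a b :: "real \<times> (real^'n)"
    unfolding steady_state_metric_def
    by (rule ddI) (auto intro!: derivative_eq_intros)
  then show ?thesis
    unfolding christoffel_def dd_def[symmetric]
    by (intro sharp_steady_state)
      (simp add: steady_state_metric_def inner_add_left inner_commute algebra_simps)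
qed

lemma dd_vertical_graph:
  "smooth u \<Longrightarrow> dd v (vertical_graph u) x = (dd v u x, v)"
  unfolding vertical_graph_def[abs_def] by (simp add: dd_Pair)

lemma induced_metric_vertical_graph:
  "smooth u \<Longrightarrow> induced_metric steady_state_metric (vertical_graph u) x v w
    = exp (2 * u x) * (v \<bullet> w) - dd v u x * dd w u x"
  by (simp add: induced_metric_def dd_def[symmetric] dd_vertical_graph)
    (simp add: steady_state_metric_def vertical_graph_def)

context
  fixes u :: "real^'n \<Rightarrow> real"
  assumes spacelike_graph: "spacelike_graph u"
begin

interpretation spacelike_graph u by (rule spacelike_graph)

lemma induced_metric_eq_gm: "induced_metric steady_state_metric (vertical_graph u) = gm"
  by (intro ext) (simp add: induced_metric_vertical_graph gm_def)

text \<open>Orthogonality ties the spatial part to the time part \<open>a\<close>, the unit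
  condition forces \<open>a^2 = c^2\<close>, and the time orientation selects
  \<open>a = c\<close>.\<close>

lemma future_unit_normal_eq:
  assumes "future_unit_normal (vertical_graph u) N"
  shows "N = (\<lambda>x. (c x, - V x *\<^sub>R q x))"
proof
  fix x
  define a n where "a = fst (N x)" and "n = snd (N x)"
  have orth: "a * dd v u x = exp (2 * u x) * (n \<bullet> v)" for v
    using assms by (simp add: future_unit_normal_def dd_def[symmetric] dd_vertical_graph)
      (simp add: steady_state_metric_def vertical_graph_def a_def n_def)
  have unit: "- (a * a) + exp (2 * u x) * (n \<bullet> n) = - 1" and pos: "a > 0"
    using assms by (auto simp: future_unit_normal_def steady_state_metric_def vertical_graph_def d_t_def a_def n_def)
  have "n \<bullet> v = (- a * V x) *\<^sub>R p x \<bullet> v" for v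
  proof -
    have "n \<bullet> v = V x * V x * (exp (2 * u x) * (n \<bullet> v))" by (simp add: exp_u)
    also have "\<dots> = (- a * V x) *\<^sub>R p x \<bullet> v"
      unfolding orth[symmetric] unfolding dd_u exp_u by (simp add: inner_commute)
    finally show ?thesis .
  qed
  then have n: "n = (- a * V x) *\<^sub>R p x" using vector_eq_rdot by blast
  have "a * a * (1 - p x \<bullet> p x) = 1"
    using unit unfolding n exp_u by (simp add: algebra_simps)
  then have "a * a * (1 - p x \<bullet> p x) = c x * c x * (1 - p x \<bullet> p x)" by (simp add: c_square)
  then have "a\<^sup>2 = (c x)\<^sup>2" using norm_p_less_1[of x] by (simp add: power2_eq_square)
  then have "a = c x" using pos c_pos[of x] by (simp add: power2_eq_iff_nonneg less_imp_le)
  with n show "N x = (c x, - V x *\<^sub>R q x)"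
    by (intro prod_eqI) (simp_all add: a_def n_def q_def mult.commute)
qed

lemma shape_operator_eq:
  "shape_operator steady_state_metric (vertical_graph u) (\<lambda>x. (c x, - V x *\<^sub>R q x)) x v = - W x v"
proof -
  have 1: "dd v (\<lambda>x. (c x, - V x *\<^sub>R q x)) x = (dd v c x, - (v \<bullet> p x) *\<^sub>R q x - V x *\<^sub>R dd v q x)"
    by (simp add: dd_Pair)
  have cov: "cov_deriv_along steady_state_metric (vertical_graph u) (\<lambda>x. (c x, - V x *\<^sub>R q x)) x v
      = (dd v c x - (v \<bullet> q x) / V x, W x v)"
    unfolding cov_deriv_along_def dd_def[symmetric] christoffel_steady_state 1
    by (simp add: dd_vertical_graph vertical_graph_def dd_u exp_u W_def)
  \<comment> \<open>Tangency of the derivative of the normal: its time component is the differential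
    of \<open>u\<close> on its spatial component \<open>W x v\<close>, which thus determines the
    preimage.\<close>
  have "dd (W x v) u x = dd v c x - (v \<bullet> q x) / V x"
    unfolding dd_c_eq dd_u exp_u
    by (simp add: W_def inner_diff_left inner_diff_right q_def inner_commute diff_divide_distrib)
  moreover have "dd (- W x v) u x = - dd (W x v) u x"
    using dd_scaleR_dir[OF smooth_u, of "- 1" "W x v" x] by simp
  ultimately show ?thesis
    unfolding shape_operator_def cov unfolding dd_def[symmetric]
    by (intro the_equality) (auto simp: dd_vertical_graph)
qed

lemma mean_curvature_eq:
  "mean_curvature steady_state_metric (vertical_graph u) (\<lambda>x. (c x, - V x *\<^sub>R q x)) x
    = lin_trace (W x) / DIM(real^'n)"
  unfolding mean_curvature_def shape_operator_eq lin_trace_def by (simp add: sum_negf)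

end

theorem theorem4p1:
  fixes u :: "real^'n \<Rightarrow> real"
    and \<psi> N :: "real^'n \<Rightarrow> real \<times> (real^'n)"
    and g :: "(real^'n) metric"
    and \<theta> :: "real^'n \<Rightarrow> real"
    and H :: real
  assumes dim: "CARD('n) \<ge> 2"
    and u_smooth: "smooth u"
    and u_nonneg: "\<forall>x. u x \<ge> 0"
    and graph: "\<psi> = vertical_graph u"
    and metric: "g = induced_metric steady_state_metric \<psi>"
    and spacelike: "riemannian g"
    and complete: "riem_complete g"
    and normal: "future_unit_normal \<psi> N"
    and angle: "hyperbolic_angle \<psi> N \<theta>"
    and cmc: "\<forall>x. mean_curvature steady_state_metric \<psi> N x = H"
    and H_ge_1: "H \<ge> 1"
    and height_bound:
      "\<forall>x. cosh (\<theta> x) \<noteq> 1 \<longrightarrow> height \<psi> x \<le> - ln (cosh (\<theta> x) - 1)"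
  shows "H = 1 \<and>
         (\<forall>x. scalar_curvature g x \<ge> 0) \<and>
         \<not> (\<exists>\<alpha>>0. \<forall>x. scalar_curvature g x \<ge> \<alpha>)"
proof -
  have graph_u: "spacelike_graph u"
  proof
    fix v :: "real^'n" and x
    assume "v \<noteq> 0"
    then have "g x v v > 0" using spacelike by (simp add: riemannian_def)
    then show "(dd v u x)\<^sup>2 < exp (2 * u x) * (v \<bullet> v)"
      by (simp add: metric graph induced_metric_vertical_graph u_smooth power2_eq_square)
  qed (rule u_smooth)
  interpret spacelike_graph u by (rule graph_u)
  have N: "N = (\<lambda>x. (c x, - V x *\<^sub>R q x))"
    using normal unfolding graph by (rule future_unit_normal_eq[OF graph_u])
  have gm: "g = gm"
    unfolding metric graph by (rule induced_metric_eq_gm[OF graph_u])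
  have V_le: "V x \<le> 1" for x
    using u_nonneg by (simp add: V_def)
  have c_le: "c x - 1 \<le> V x" for x
  \<comment> \<open>Where \<open>cosh \<theta> = 1\<close> the height bound is silent and the claim
    is \<open>0 \<le> V\<close>; elsewhere the bound is exponentiated.\<close>
  proof (cases "c x = 1")
    case False
    have "cosh (\<theta> x) = c x"
      using angle by (simp add: hyperbolic_angle_def N steady_state_metric_def d_t_def)
    then have "u x \<le> - ln (c x - 1)"
      using height_bound[rule_format, of x] False by (simp only: height_def graph vertical_graph_def fst_conv simp_thms)
    then have "exp (ln (c x - 1)) \<le> exp (- u x)" by simp
    then show ?thesis using False c_ge_1[of x] by (simp add: V_def)
  qed (simp add: less_imp_le)
  have H: "lin_trace (W x) = DIM(real^'n) * H" for x
    using cmc mean_curvature_eq[OF graph_u, of x] by (simp add: N graph field_simps)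
  show ?thesis
    using cmc_rigidity[OF V_le c_le H H_ge_1] unfolding gm by (auto simp: not_le)
qed

end
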